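(* Suppose the arrival probabilities $\boldsymbol p$ are known. Fix $\beta\in(\tfrac12,1)$ and run the AIR-KP policy with resolving set $\mathcal T^{\mathcal K}=\{1\}\cup\{\lceil T-T^{\beta^k}\rceil: k=1,\dots,K_A\}$, where $K_A=\lceil\log_{1/\beta}\log_3T\rceil$. Then the regret of the AIR-KP policy is $\mathcal O(1)$.
   Context: Setting: $m$ resources, $n$ customer types; type $j$ has reward $r_j\ge0$ and consumption $\boldsymbol A_j\in\mathbb R_+^m$ (columns of $\boldsymbol A$); $T$ periods; initial inventory $T\boldsymbol\rho$, $\boldsymbol\rho\in\mathbb R^m_+$. Each period one customer arrives with type drawn i.i.d. from $\boldsymbol p$ ($p_j>0$ for all $j$), which here is known. Each arrival is irrevocably accepted (consuming $\boldsymbol A_j$, earning $r_j$) or rejected, never exceeding the inventory. $V^*(T)$ is the optimal expected reward over feasible non-anticipative policies, and the regret of a policy $\mu$ is $V^*(T)$ minus its expected reward. $\phi(\boldsymbol b,\boldsymbol d)=\max\{\boldsymbol r^\top\boldsymbol y:\boldsymbol A\boldsymbol y\le\boldsymbol b,\ \boldsymbol 0\le\boldsymbol y\le\boldsymbol d\}$. AIR-KP policy with resolving set $\mathcal T$: maintain inventory $\boldsymbol b^t$ ($\boldsymbol b^1=T\boldsymbol\rho$) and vectors $\boldsymbol u^t,\boldsymbol d^t$ ($\boldsymbol u^1=\boldsymbol d^1=\boldsymbol 0$). In period $t$: if $t\in\mathcal T$, take an optimal solution $\boldsymbol y^*$ of $\phi(\boldsymbol b^t,(T-t+1)\boldsymbol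 p)$ and reset $\boldsymbol u^t=\boldsymbol y^*$, $\boldsymbol d^t=(T-t+1)\boldsymbol p$. Observe type $j$; if $\boldsymbol A_j\le\boldsymbol b^t$, $u^t_j>1$ and $u^t_j\ge d^t_j-u^t_j$, accept, $\boldsymbol b^{t+1}=\boldsymbol b^t-\boldsymbol A_j$, $\boldsymbol u^{t+1}=\boldsymbol u^t-\boldsymbol e_j$; otherwise reject, $\boldsymbol b^{t+1}=\boldsymbol b^t$, $\boldsymbol u^{t+1}=\boldsymbol u^t$. Always $\boldsymbol d^{t+1}=\boldsymbol d^t-\boldsymbol e_j$. $\mathcal O(1)$ means bounded by a constant independent of $T$ (possibly depending on the instance and $\beta$). *)

theory Defs
  imports "HOL-Probability.Probability"
begin

text \<open>
  A history lists the periods already played as pairs (customer type, accepted?), most recent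
  period first; at the beginning of period \<open>t\<close> it has length \<open>t - 1\<close>. A policy may
  depend on the whole history and on the current type, and may randomise, but sees nothing of the
  future.
\<close>

type_synonym 'n history = "('n \<times> bool) list"
type_synonym 'n policy = "'n history \<Rightarrow> 'n \<Rightarrow> bool pmf"

primrec trajectory :: "'n pmf \<Rightarrow> 'n policy \<Rightarrow> nat \<Rightarrow> 'n history pmf" where
  "trajectory p \<mu> 0 = return_pmf []"
| "trajectory p \<mu> (Suc t) =
     bind_pmf (trajectory p \<mu> t) (\<lambda>h.
     bind_pmf p (\<lambda>j.
     bind_pmf (\<mu> h j) (\<lambda>x. return_pmf ((j, x) # h))))"

primrec inventory :: "real^'n^'m \<Rightarrow> real^'m \<Rightarrow> 'n history \<Rightarrow> real^'m" where
  "inventory A b [] = b"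
| "inventory A b (e # h) = inventory A b h - (if snd e then column (fst e) A else 0)"

primrec collected :: "real^'n \<Rightarrow> 'n history \<Rightarrow> real" where
  "collected r [] = 0"
| "collected r (e # h) = collected r h + (if snd e then r $ fst e else 0)"

definition feasible_policy ::
    "real^'n^'m \<Rightarrow> real^'m \<Rightarrow> 'n pmf \<Rightarrow> nat \<Rightarrow> 'n policy \<Rightarrow> bool" where
  "feasible_policy A \<rho> p T \<mu> \<longleftrightarrow>
     (\<forall>t\<le>T. \<forall>h\<in>set_pmf (trajectory p \<mu> t). 0 \<le> inventory A (real T *\<^sub>R \<rho>) h)"

definition expected_reward :: "real^'n \<Rightarrow> 'n pmf \<Rightarrow> nat \<Rightarrow> 'n policy \<Rightarrow> real" where
  "expected_reward r p T \<mu> = measure_pmf.expectation (trajectory p \<mu> T) (collected r)"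

definition optimal_value ::
    "real^'n^'m \<Rightarrow> real^'n \<Rightarrow> real^'m \<Rightarrow> 'n pmf \<Rightarrow> nat \<Rightarrow> real" where
  "optimal_value A r \<rho> p T = (SUP \<mu>\<in>{\<mu>. feasible_policy A \<rho> p T \<mu>}. expected_reward r p T \<mu>)"

definition regret ::
    "real^'n^'m \<Rightarrow> real^'n \<Rightarrow> real^'m \<Rightarrow> 'n pmf \<Rightarrow> nat \<Rightarrow> 'n policy \<Rightarrow> real" where
  "regret A r \<rho> p T \<mu> = optimal_value A r \<rho> p T - expected_reward r p T \<mu>"

text \<open>The order on vectors is componentwise.\<close>

definition lp_optimal ::
    "real^'n^'m \<Rightarrow> real^'n \<Rightarrow> real^'m \<Rightarrow> real^'n \<Rightarrow> real^'n \<Rightarrow> bool" where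
  "lp_optimal A r b d = is_arg_max (\<lambda>y. r \<bullet> y) (\<lambda>y. A *v y \<le> b \<and> 0 \<le> y \<and> y \<le> d)"

text \<open>
  Expected number of arrivals of each type in the periods that remain after history \<open>h\<close>;
  with \<open>t = length h + 1\<close> the factor is \<open>T - t + 1\<close>.
\<close>

definition remaining_demand :: "'n::finite pmf \<Rightarrow> nat \<Rightarrow> 'n history \<Rightarrow> real^'n" where
  "remaining_demand p T h = (real T - real (length h)) *\<^sub>R (\<chi> j. pmf p j)"

text \<open>
  The linear program may have several optimal solutions. The policy is therefore parameterised by
  a rule \<open>sel\<close> that picks the solution used when re-solving after history \<open>h\<close>; the rule is
  only constrained in resolving periods and at nonnegative inventories.
\<close>

definition optimal_selection ::
    "real^'n^'m \<Rightarrow> real^'n \<Rightarrow> real^'m \<Rightarrow> 'n pmf \<Rightarrow> nat \<Rightarrow> nat set \<Rightarrow> ('n history \<Rightarrow> real^'n) \<Rightarrow> bool"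
  where
  "optimal_selection A r \<rho> p T R sel \<longleftrightarrow>
     (\<forall>h. Suc (length h) \<in> R \<longrightarrow> 0 \<le> inventory A (real T *\<^sub>R \<rho>) h \<longrightarrow>
        lp_optimal A r (inventory A (real T *\<^sub>R \<rho>) h) (remaining_demand p T h) (sel h))"

definition resolve ::
    "'n pmf \<Rightarrow> nat \<Rightarrow> nat set \<Rightarrow> ('n history \<Rightarrow> real^'n) \<Rightarrow> 'n history \<Rightarrow>
     (real^'n) \<times> (real^'n) \<Rightarrow> (real^'n) \<times> (real^'n)" where
  "resolve p T R sel h ud =
     (if Suc (length h) \<in> R then (sel h, remaining_demand p T h) else ud)"

text \<open>
  The pair \<open>(u, d)\<close> in the period following history \<open>h\<close>, after any re-solving at the start
  of that period.
\<close>

primrec air_kp_plan ::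
    "'n pmf \<Rightarrow> nat \<Rightarrow> nat set \<Rightarrow> ('n history \<Rightarrow> real^'n) \<Rightarrow> 'n history \<Rightarrow>
     (real^'n) \<times> (real^'n)" where
  "air_kp_plan p T R sel [] = resolve p T R sel [] (0, 0)"
| "air_kp_plan p T R sel (e # h) =
     resolve p T R sel (e # h)
       (let (u, d) = air_kp_plan p T R sel h
        in (u - (if snd e then axis (fst e) 1 else 0), d - axis (fst e) 1))"

definition air_kp ::
    "real^'n^'m \<Rightarrow> real^'m \<Rightarrow> 'n pmf \<Rightarrow> nat \<Rightarrow> nat set \<Rightarrow> ('n history \<Rightarrow> real^'n) \<Rightarrow> 'n policy" where
  "air_kp A \<rho> p T R sel h j =
     (let (u, d) = air_kp_plan p T R sel h
      in return_pmf (column j A \<le> inventory A (real T *\<^sub>R \<rho>) h \<and> u $ j > 1 \<and> u $ j \<ge> d $ j - u $ j))"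

text \<open>
  For \<open>T \<le> 2\<close> the number of re-solving times is zero: \<open>log 3 T < 1\<close>, so the outer logarithm
  is at most 0 (at \<open>T = 1\<close> its argument is 0, and the library convention \<open>ln 0 = 0\<close> applies).
\<close>

definition resolving_set :: "real \<Rightarrow> nat \<Rightarrow> nat set" where
  "resolving_set \<beta> T =
     {1} \<union> (\<lambda>k. nat \<lceil>real T - real T powr (\<beta> ^ k)\<rceil>) ` {1..nat \<lceil>log (1 / \<beta>) (log 3 (real T))\<rceil>}"

end

theory Submission imports Defs "HOL-Real_Asymp.Real_Asymp" begin

text \<open>
  Compare the policy with a clairvoyant who knows all future arrivals. In each period, take the
  reward collected so far plus the expected optimal value of the linear program whose bounds are
  the current inventory and the random remaining arrivals. For a feasible policy this quantity
  never increases, so its initial value bounds the optimal expected reward from above. It remains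
  to bound the sum of its decreases under AIR-KP.

  Between two re-solving times the vector \<open>u\<close> stays optimal for the bounds \<open>d\<close>, and
  \<open>d\<close> differs from the actual remaining arrivals only by the deviation of the arrivals
  since the last re-solving time from their mean. Optimal solutions of a linear program depend on
  the upper bounds in a Lipschitz way, so a decision taken with margin proportional to the number
  \<open>n\<close> of remaining periods is also made by some optimal clairvoyant solution, and nothing is lost
  unless the deviation is of order \<open>n\<close>. If \<open>N\<close> periods remained at the last re-solving
  time, then \<open>N powr \<beta> \<le> 2 * n\<close> unless \<open>N \<le> 4\<close>, and Hoeffding's
  inequality bounds the expected loss by a multiple of
  \<open>exp (- (a * n powr (2 - 1 / \<beta>)))\<close>. This is summable over \<open>n\<close> since
  \<open>\<beta> > 1 / 2\<close>.
\<close>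

section \<open>Lipschitz dependence of optimal solutions on the upper bounds\<close>

text \<open>Fixing the sign of every coordinate and of every resource use rules out cancellation in
  sums of members. Finitely many such cones cover the space, so finitely many generators serve all
  pairs of solutions.\<close>

definition sign_cone :: "real^'n^'m \<Rightarrow> 'n set \<Rightarrow> 'm set \<Rightarrow> (real^'n) set" where
  "sign_cone A S P = {w. (\<forall>j\<in>S. 0 \<le> w $ j) \<and> (\<forall>j\<in>-S. w $ j \<le> 0) \<and>
     (\<forall>i\<in>P. 0 \<le> (A *v w) $ i) \<and> (\<forall>i\<in>-P. (A *v w) $ i \<le> 0)}"

lemma polyhedron_sign_cone: "polyhedron (sign_cone A S P)"
proof -
  have "sign_cone A S P =
      \<Inter>((\<lambda>j. {w. axis j 1 \<bullet> w \<ge> 0}) ` S) \<inter> \<Inter>((\<lambda>j. {w. axis j 1 \<bullet> w \<le> 0}) ` (-S)) \<inter>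
      \<Inter>((\<lambda>i. {w. A $ i \<bullet> w \<ge> 0}) ` P) \<inter> \<Inter>((\<lambda>i. {w. A $ i \<bullet> w \<le> 0}) ` (-P))"
    by (auto simp: sign_cone_def inner_axis' matrix_vector_mul_component)
  then show ?thesis
    by (auto intro!: polyhedron_Inter polyhedron_Int
        simp: polyhedron_halfspace_ge polyhedron_halfspace_le)
qed

lemma sign_cone_scaleR: "0 \<le> c \<Longrightarrow> w \<in> sign_cone A S P \<Longrightarrow> c *\<^sub>R w \<in> sign_cone A S P"
  by (auto simp: sign_cone_def matrix_vector_mult_scaleR mult_nonneg_nonpos)

lemma sign_cone_add:
  "v \<in> sign_cone A S P \<Longrightarrow> w \<in> sign_cone A S P \<Longrightarrow> v + w \<in> sign_cone A S P"
  by (auto simp: sign_cone_def matrix_vector_right_distrib add_nonpos_nonpos)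

lemma sign_cone_sum:
  "(\<And>g. g \<in> I \<Longrightarrow> f g \<in> sign_cone A S P) \<Longrightarrow> (\<Sum>g\<in>I. f g) \<in> sign_cone A S P"
proof (induction I rule: infinite_finite_induct)
  case (insert x F)
  then show ?case by (simp add: sign_cone_add)
qed (auto simp: sign_cone_def)

text \<open>Capping the cone with a box makes it a polytope; its vertices generate the cone.\<close>

lemma sign_cone_finitely_generated:
  fixes A :: "real^'n^'m"
  obtains G where "finite G" "G \<subseteq> sign_cone A S P"
    "\<And>w. w \<in> sign_cone A S P \<Longrightarrow> \<exists>l. (\<forall>g\<in>G. 0 \<le> l g) \<and> w = (\<Sum>g\<in>G. l g *\<^sub>R g)"
proof -
  let ?B = "cbox (-1) 1 :: (real^'n) set"
  have "polytope (?B \<inter> sign_cone A S P)"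
    by (intro polytope_Int_polyhedron polytope_interval polyhedron_sign_cone)
  then obtain G where G: "finite G" "?B \<inter> sign_cone A S P = convex hull G"
    by (auto simp: polytope_def)
  show thesis
  proof
    show "finite G" by fact
    show "G \<subseteq> sign_cone A S P" using G hull_subset[of G convex] by blast
    fix w assume w: "w \<in> sign_cone A S P"
    define c where "c = norm w + 1"
    have c: "c > 0" by (simp add: c_def add_nonneg_pos)
    have "\<bar>w $ j\<bar> \<le> c" for j using component_le_norm_cart[of w j] by (simp add: c_def)
    then have "(1 / c) *\<^sub>R w \<in> ?B"
      using c by (auto simp: mem_box_cart field_simps abs_le_iff) (smt (verit))
    with sign_cone_scaleR[OF _ w, of "1/c"] c have "(1 / c) *\<^sub>R w \<in> convex hull G"
      unfolding G(2)[symmetric] by auto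
    then obtain u where u: "\<forall>x\<in>G. 0 \<le> u x" "(\<Sum>x\<in>G. u x *\<^sub>R x) = (1 / c) *\<^sub>R w"
      by (auto simp: convex_hull_finite[OF G(1)])
    have "w = (\<Sum>x\<in>G. (c * u x) *\<^sub>R x)"
      using arg_cong[OF u(2), of "scaleR c"] c by (simp add: scaleR_sum_right)
    then show "\<exists>l. (\<forall>g\<in>G. 0 \<le> l g) \<and> w = (\<Sum>g\<in>G. l g *\<^sub>R g)"
      using u(1) c by (intro exI[of _ "\<lambda>x. c * u x"]) auto
  qed
qed

section \<open>Feasible and optimal solutions of the linear program\<close>

definition lp_feasible :: "real^'n^'m \<Rightarrow> real^'m \<Rightarrow> real^'n \<Rightarrow> real^'n \<Rightarrow> bool" where
  "lp_feasible A b d y \<longleftrightarrow> A *v y \<le> b \<and> 0 \<le> y \<and> y \<le> d"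

lemma lp_optimal_iff:
  "lp_optimal A r b d y \<longleftrightarrow> lp_feasible A b d y \<and> (\<forall>z. lp_feasible A b d z \<longrightarrow> r \<bullet> z \<le> r \<bullet> y)"
  by (auto simp: lp_optimal_def is_arg_max_linorder lp_feasible_def)

lemma compact_lp_feasible: "compact {y. lp_feasible A b d y}"
proof -
  have "{y. lp_feasible A b d y} = cbox 0 d \<inter> (\<Inter>i. {y. A $ i \<bullet> y \<le> b $ i})"
    by (auto simp: lp_feasible_def less_eq_vec_def mem_box_cart matrix_vector_mul_component)
  moreover have "closed (\<Inter>i. {y. A $ i \<bullet> y \<le> b $ i})"
    by (intro closed_INT ballI closed_halfspace_le)
  ultimately show ?thesis by (simp add: compact_Int_closed)
qed

lemma lp_optimal_exists:
  assumes "lp_feasible A b d y0"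
  obtains y where "lp_optimal A r b d y"
proof -
  have "\<exists>y\<in>{y. lp_feasible A b d y}. \<forall>z\<in>{y. lp_feasible A b d y}. r \<bullet> z \<le> r \<bullet> y"
    using assms by (intro continuous_attains_sup compact_lp_feasible continuous_intros) auto
  then show thesis using that by (auto simp: lp_optimal_iff)
qed

lemma compact_lp_optimal: "compact {y. lp_optimal A r b d y}"
proof -
  have "{y. lp_optimal A r b d y} =
      {y. lp_feasible A b d y} \<inter> (\<Inter>z\<in>{z. lp_feasible A b d z}. {y. r \<bullet> z \<le> r \<bullet> y})"
    by (auto simp: lp_optimal_iff)
  moreover have "closed (\<Inter>z\<in>{z. lp_feasible A b d z}. {y. r \<bullet> z \<le> r \<bullet> y})"
    by (intro closed_INT ballI closed_Collect_le continuous_intros)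
  ultimately show ?thesis by (simp add: compact_Int_closed compact_lp_feasible)
qed

text \<open>The set of optimal solutions is compact. The distance is a sum of absolute values
  because that sum is additive on vectors of equal signs.\<close>

lemma lp_optimal_closest:
  assumes "lp_feasible A b d y0"
  obtains y where "lp_optimal A r b d y"
    "\<And>z. lp_optimal A r b d z \<Longrightarrow> (\<Sum>j\<in>UNIV. \<bar>y $ j - u $ j\<bar>) \<le> (\<Sum>j\<in>UNIV. \<bar>z $ j - u $ j\<bar>)"
proof -
  have "\<exists>y\<in>{y. lp_optimal A r b d y}. \<forall>z\<in>{y. lp_optimal A r b d y}.
      (\<Sum>j\<in>UNIV. \<bar>y $ j - u $ j\<bar>) \<le> (\<Sum>j\<in>UNIV. \<bar>z $ j - u $ j\<bar>)"
  proof (rule continuous_attains_inf)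
    show "{y. lp_optimal A r b d y} \<noteq> {}" using lp_optimal_exists[OF assms, of r] by auto
  qed (intro compact_lp_optimal continuous_intros)+
  then show thesis using that by auto
qed

section \<open>Exchange along a generator\<close>

lemma common_step_size:
  fixes v w z :: "'a::finite \<Rightarrow> real"
  assumes "\<And>j. w j > 0 \<Longrightarrow> v j < z j" "\<And>j. v j \<le> z j"
  obtains e where "0 < e" "\<And>t j. 0 \<le> t \<Longrightarrow> t \<le> e \<Longrightarrow> v j + t * w j \<le> z j"
proof -
  have "\<forall>j. \<exists>f>0. v j + f * w j \<le> z j"
  proof
    fix j
    consider "w j > 0" | "w j \<le> 0" by linarith
    then show "\<exists>f>0. v j + f * w j \<le> z j"
    proof cases
      case 1
      then show ?thesis using assms(1)[of j] by (intro exI[of _ "(z j - v j) / w j"]) auto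
    next
      case 2
      then show ?thesis using assms(2)[of j] by (intro exI[of _ 1]) auto
    qed
  qed
  then obtain f where f: "\<And>j. f j > 0" "\<And>j. v j + f j * w j \<le> z j" by metis
  define e where "e = Min (range f)"
  have e: "e > 0" "e \<le> f j" for j
    using f(1) by (auto simp: e_def)
  have "v j + t * w j \<le> z j" if t: "0 \<le> t" "t \<le> e" for t j
  proof (cases "w j > 0")
    case True
    then show ?thesis using f(2)[of j] e(2)[of j] t mult_right_mono[of t "f j" "w j"] by linarith
  next
    case False
    then have "t * w j \<le> 0" using t by (simp add: mult_nonneg_nonpos)
    then show ?thesis using assms(2)[of j] by linarith
  qed
  with e that show thesis by blast
qed

text \<open>Along \<open>g\<close> and then \<open>s\<close> each constraint moves in one direction
  only, so at the intermediate point it is no worse than at one of the two ends. The upper bounds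
  are left out because they differ between the two programs compared.\<close>

lemma sign_cone_step:
  assumes g: "g \<in> sign_cone A S P" and s: "s \<in> sign_cone A S P"
    and "A *v u \<le> b" "A *v (u + g + s) \<le> b" "0 \<le> u" "0 \<le> u + g + s"
  shows "A *v (u + g) \<le> b" "0 \<le> u + g"
proof -
  have "(A *v (u + g)) $ i \<le> b $ i" for i
  proof (cases "i \<in> P")
    case True
    then have "(A *v (u + g)) $ i \<le> (A *v (u + g + s)) $ i"
      using s by (simp add: sign_cone_def matrix_vector_right_distrib)
    then show ?thesis using assms(4) by (auto simp: less_eq_vec_def intro: order_trans)
  next
    case False
    then have "(A *v (u + g)) $ i \<le> (A *v u) $ i"
      using g by (simp add: sign_cone_def matrix_vector_right_distrib)
    then show ?thesis using assms(3) by (auto simp: less_eq_vec_def intro: order_trans)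
  qed
  then show "A *v (u + g) \<le> b" by (simp add: less_eq_vec_def)
  have "0 \<le> (u + g) $ j" for j
  proof (cases "j \<in> S")
    case True
    then have "u $ j \<le> (u + g) $ j" using g by (simp add: sign_cone_def)
    then show ?thesis using assms(5) by (auto simp: less_eq_vec_def intro: order_trans)
  next
    case False
    then have "(u + g + s) $ j \<le> (u + g) $ j" using s by (simp add: sign_cone_def)
    moreover have "0 \<le> (u + g + s) $ j" using assms(6) by (simp add: less_eq_vec_def)
    ultimately show ?thesis by (rule order_trans[rotated])
  qed
  then show "0 \<le> u + g" by (simp add: less_eq_vec_def)
qed

text \<open>
  The difference between an optimal solution \<open>u\<close> for \<open>d\<close> and the optimal solution for \<open>d'\<close>
  closest to it is a sign-compatible combination of finitely many generators. A generator with a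
  large coefficient could be added to \<open>u\<close> or subtracted from the other solution, so it would be
  neutral for the objective and could be cancelled, contradicting closeness. Hence every generator is
  blocked by an upper bound that differs between \<open>d\<close> and \<open>d'\<close>, which limits its coefficient.
\<close>

lemma generator_blocked:
  assumes u: "lp_optimal A r b d u" and y: "lp_optimal A r b d' y"
    and closest: "\<And>z. lp_optimal A r b d' z \<Longrightarrow>
      (\<Sum>j\<in>UNIV. \<bar>y $ j - u $ j\<bar>) \<le> (\<Sum>j\<in>UNIV. \<bar>z $ j - u $ j\<bar>)"
    and \<delta>: "\<And>j. \<bar>d' $ j - d $ j\<bar> \<le> \<delta>"
    and g: "g \<in> sign_cone A S P" and s: "s \<in> sign_cone A S P"
    and yu: "y = u + c *\<^sub>R g + s" and "0 < c" and "g \<noteq> 0"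
  obtains j where "g $ j \<noteq> 0" "c * \<bar>g $ j\<bar> \<le> \<delta>"
proof (rule ccontr)
  assume "\<not> thesis"
  then have big: "\<delta> < c * \<bar>g $ j\<bar>" if "g $ j \<noteq> 0" for j
    using that \<open>\<And>j. g $ j \<noteq> 0 \<Longrightarrow> c * \<bar>g $ j\<bar> \<le> \<delta> \<Longrightarrow> thesis\<close> by force
  have uf: "A *v u \<le> b" "0 \<le> u" "\<And>j. u $ j \<le> d $ j"
    and yf: "A *v y \<le> b" "0 \<le> y" "\<And>j. y $ j \<le> d' $ j"
    using u y by (auto simp: lp_optimal_iff lp_feasible_def less_eq_vec_def)
  have y_nth: "y $ j = u $ j + c * g $ j + s $ j" for j by (simp add: yu)
  \<comment> \<open>\<open>s\<close> does not lower this coordinate, so \<open>y\<close> exceeds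
    \<open>u\<close> by more than \<open>\<delta>\<close> there; since \<open>y\<close> respects
    \<open>d'\<close>, the bound \<open>d\<close> leaves room above \<open>u\<close>.\<close>
  have up: "u $ j < d $ j" if pos: "g $ j > 0" for j
  proof -
    have "\<not> g $ j \<le> 0" using pos by simp
    then have "j \<in> S" using g by (auto simp: sign_cone_def)
    then have "s $ j \<ge> 0" using s by (simp add: sign_cone_def)
    moreover have "\<delta> < c * g $ j" using big[of j] pos by simp
    ultimately show ?thesis using y_nth[of j] yf(3)[of j] \<delta>[of j] by linarith
  qed
  have down: "y $ j < d' $ j" if neg: "- (g $ j) > 0" for j
  proof -
    have "\<not> 0 \<le> g $ j" using neg by simp
    then have "j \<notin> S" using g by (auto simp: sign_cone_def)
    then have "s $ j \<le> 0" using s by (simp add: sign_cone_def)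
    moreover have "\<delta> < c * - (g $ j)" using big[of j] neg by simp
    ultimately show ?thesis using y_nth[of j] uf(3)[of j] \<delta>[of j] by linarith
  qed
  obtain e1 where e1: "e1 > 0" "\<And>t j. 0 \<le> t \<Longrightarrow> t \<le> e1 \<Longrightarrow> u $ j + t * g $ j \<le> d $ j"
    using common_step_size[of "($) g" "($) u" "($) d"] up uf(3) by metis
  obtain e2 where e2: "e2 > 0" "\<And>t j. 0 \<le> t \<Longrightarrow> t \<le> e2 \<Longrightarrow> y $ j + t * - (g $ j) \<le> d' $ j"
    using common_step_size[of "\<lambda>j. - (g $ j)" "($) y" "($) d'"] down yf(3) by metis
  \<comment> \<open>A step valid from both ends; the cap \<open>c\<close> keeps
    \<open>(c - e) *\<^sub>R g\<close> in the cone.\<close>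
  define e where "e = min c (min e1 e2)"
  have e: "e > 0" "e \<le> c" "e \<le> e1" "e \<le> e2" using e1 e2 \<open>0 < c\<close> by (auto simp: e_def)
  define h where "h = (c - e) *\<^sub>R g + s"
  have eg: "e *\<^sub>R g \<in> sign_cone A S P" using e g by (simp add: sign_cone_scaleR)
  have h: "h \<in> sign_cone A S P"
    unfolding h_def using e g s by (intro sign_cone_add sign_cone_scaleR) auto
  have y1: "u + e *\<^sub>R g + h = y" "u + h + e *\<^sub>R g = y"
    unfolding yu h_def by (simp_all add: algebra_simps)
  \<comment> \<open>Optimality of \<open>u\<close> forbids a gain along \<open>g\<close>, so taking
    the same step off \<open>y\<close> costs no reward.\<close>
  have "lp_feasible A b d (u + e *\<^sub>R g)"
    using sign_cone_step[OF eg h uf(1) _ uf(2), unfolded y1, OF yf(1,2)] e1(2)[of e] e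
    by (simp add: lp_feasible_def less_eq_vec_def)
  then have "r \<bullet> (u + e *\<^sub>R g) \<le> r \<bullet> u" using u by (auto simp: lp_optimal_iff)
  then have rg: "r \<bullet> (e *\<^sub>R g) \<le> 0" by (simp add: inner_add_right)
  have uh: "u + h = y - e *\<^sub>R g" by (simp add: y1(1)[symmetric])
  have "lp_feasible A b d' (u + h)"
    using sign_cone_step[OF h eg uf(1) _ uf(2), unfolded y1, OF yf(1,2)] e2(2)[of e] e
    by (simp add: lp_feasible_def less_eq_vec_def uh)
  moreover have "r \<bullet> y \<le> r \<bullet> (u + h)" using rg by (simp add: uh inner_diff_right)
  ultimately have "lp_optimal A r b d' (u + h)"
    using y by (fastforce simp: lp_optimal_iff)
  from closest[OF this] have le: "(\<Sum>j\<in>UNIV. \<bar>y $ j - u $ j\<bar>) \<le> (\<Sum>j\<in>UNIV. \<bar>h $ j\<bar>)" by simp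
  \<comment> \<open>\<open>e *\<^sub>R g\<close> and \<open>h\<close> agree in sign everywhere, so
    the distance splits, and closeness of \<open>y\<close> forces the share of \<open>g\<close> to
    vanish.\<close>
  have "\<bar>y $ j - u $ j\<bar> = e * \<bar>g $ j\<bar> + \<bar>h $ j\<bar>" for j
  proof -
    have yj: "y $ j - u $ j = (e *\<^sub>R g) $ j + h $ j" by (simp add: y1(1)[symmetric])
    have "\<bar>y $ j - u $ j\<bar> = \<bar>(e *\<^sub>R g) $ j\<bar> + \<bar>h $ j\<bar>"
    proof (cases "j \<in> S")
      case True
      then have "0 \<le> (e *\<^sub>R g) $ j" "0 \<le> h $ j" using eg h unfolding sign_cone_def by blast+
      then show ?thesis unfolding yj by linarith
    next
      case False
      then have "(e *\<^sub>R g) $ j \<le> 0" "h $ j \<le> 0" using eg h unfolding sign_cone_def by blast+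
      then show ?thesis unfolding yj by linarith
    qed
    then show ?thesis using e by (simp add: abs_mult)
  qed
  then have "(\<Sum>j\<in>UNIV. \<bar>y $ j - u $ j\<bar>) = e * (\<Sum>j\<in>UNIV. \<bar>g $ j\<bar>) + (\<Sum>j\<in>UNIV. \<bar>h $ j\<bar>)"
    by (simp add: sum.distrib sum_distrib_left)
  with le have "e * (\<Sum>j\<in>UNIV. \<bar>g $ j\<bar>) \<le> 0" by linarith
  then have "(\<Sum>j\<in>UNIV. \<bar>g $ j\<bar>) \<le> 0" using e(1) by (simp add: mult_le_0_iff)
  then have "(\<Sum>j\<in>UNIV. \<bar>g $ j\<bar>) = 0" by (intro antisym sum_nonneg) auto
  then have "g = 0" by (simp add: sum_nonneg_eq_0_iff vec_eq_iff)
  with \<open>g \<noteq> 0\<close> show False ..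
qed

text \<open>The constant comes from the generators of all sign cones of \<open>A\<close>, hence is
  uniform in \<open>b\<close>, \<open>d\<close> and \<open>d'\<close> and serves every period and
  horizon.\<close>

lemma lp_optimal_lipschitz:
  fixes A :: "real^'n^'m" and r :: "real^'n"
  obtains \<kappa> where "0 \<le> \<kappa>"
    "\<And>b d d' u \<delta>. 0 \<le> b \<Longrightarrow> 0 \<le> d' \<Longrightarrow> lp_optimal A r b d u \<Longrightarrow> (\<And>j. \<bar>d' $ j - d $ j\<bar> \<le> \<delta>) \<Longrightarrow>
       \<exists>y. lp_optimal A r b d' y \<and> (\<forall>j. \<bar>y $ j - u $ j\<bar> \<le> \<kappa> * \<delta>)"
proof -
  define Q where "Q S P G \<longleftrightarrow> finite G \<and> G \<subseteq> sign_cone A S P \<and>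
      (\<forall>w\<in>sign_cone A S P. \<exists>l. (\<forall>g\<in>G. 0 \<le> l g) \<and> w = (\<Sum>g\<in>G. l g *\<^sub>R g))" for S P G
  define G where "G S P = (SOME G. Q S P G)" for S P
  have "Q S P (G S P)" for S P
  proof -
    obtain H where "Q S P H" by (rule sign_cone_finitely_generated[of A S P]) (auto simp: Q_def)
    then show ?thesis unfolding G_def by (rule someI)
  qed
  then have fin: "\<And>S P. finite (G S P)" and sub: "\<And>S P. G S P \<subseteq> sign_cone A S P"
    and gen: "\<And>S P w. w \<in> sign_cone A S P \<Longrightarrow>
      \<exists>l. (\<forall>g\<in>G S P. 0 \<le> l g) \<and> w = (\<Sum>g\<in>G S P. l g *\<^sub>R g)"
    by (auto simp: Q_def)
  \<comment> \<open>If coordinate \<open>i\<close> blocks \<open>g\<close>, its coefficient is at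
    most \<open>\<delta> * inverse \<bar>g $ i\<bar>\<close>. Summing over all \<open>i\<close>
    avoids naming the blocking one, and \<open>inverse 0 = 0\<close> makes zero coordinates
    harmless.\<close>
  define K :: "real^'n \<Rightarrow> real" where
    "K g = (\<Sum>i\<in>UNIV. inverse \<bar>g $ i\<bar>) * (\<Sum>i\<in>UNIV. \<bar>g $ i\<bar>)" for g
  have K: "0 \<le> K g" for g by (simp add: K_def sum_nonneg)
  define \<kappa> where "\<kappa> = (\<Sum>g\<in>(\<Union>S P. G S P). K g)"
  show thesis
  proof
    show "0 \<le> \<kappa>" using K by (simp add: \<kappa>_def sum_nonneg)
    fix b :: "real^'m" and d d' u :: "real^'n" and \<delta> :: real
    assume b: "0 \<le> b" and d': "0 \<le> d'" and u: "lp_optimal A r b d u"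
      and \<delta>: "\<And>j. \<bar>d' $ j - d $ j\<bar> \<le> \<delta>"
    have "lp_feasible A b d' 0" using b d' by (simp add: lp_feasible_def)
    then obtain y where y: "lp_optimal A r b d' y"
      and closest: "\<And>z. lp_optimal A r b d' z \<Longrightarrow>
        (\<Sum>j\<in>UNIV. \<bar>y $ j - u $ j\<bar>) \<le> (\<Sum>j\<in>UNIV. \<bar>z $ j - u $ j\<bar>)"
      by (rule lp_optimal_closest[of A b d' 0 r u]) blast
    have \<delta>0: "0 \<le> \<delta>" using \<delta>[of undefined] by linarith
    define S P where "S = {j. 0 \<le> (y - u) $ j}" and "P = {i. 0 \<le> (A *v (y - u)) $ i}"
    have "y - u \<in> sign_cone A S P" by (auto simp: sign_cone_def S_def P_def)
    from gen[OF this] obtain l where l: "\<And>g. g \<in> G S P \<Longrightarrow> 0 \<le> l g"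
      and yu: "y - u = (\<Sum>g\<in>G S P. l g *\<^sub>R g)" by auto
    have bound: "l g * \<bar>g $ j\<bar> \<le> K g * \<delta>" if g: "g \<in> G S P" for g j
    proof (cases "l g = 0 \<or> g = 0")
      case True
      then show ?thesis using K \<delta>0 by auto
    next
      case False
      define s where "s = (\<Sum>h\<in>G S P - {g}. l h *\<^sub>R h)"
      have s: "s \<in> sign_cone A S P"
        unfolding s_def using l sub by (intro sign_cone_sum sign_cone_scaleR) auto
      have "y = u + l g *\<^sub>R g + s"
        using yu sum.remove[OF fin g, of "\<lambda>h. l h *\<^sub>R h"] by (simp add: s_def algebra_simps)
      moreover have "0 < l g" "g \<noteq> 0" "g \<in> sign_cone A S P" using l[OF g] False g sub by auto
      ultimately obtain i where i: "g $ i \<noteq> 0" "l g * \<bar>g $ i\<bar> \<le> \<delta>"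
        using generator_blocked[OF u y closest \<delta> _ s, of g "l g"] by blast
      have "l g * \<bar>g $ j\<bar> \<le> (\<delta> * inverse \<bar>g $ i\<bar>) * \<bar>g $ j\<bar>"
        using i by (intro mult_right_mono) (auto simp: field_simps)
      also have "\<dots> \<le> (\<delta> * (\<Sum>i\<in>UNIV. inverse \<bar>g $ i\<bar>)) * (\<Sum>i\<in>UNIV. \<bar>g $ i\<bar>)"
        using \<delta>0 by (intro mult_mono mult_left_mono member_le_sum) (auto simp: sum_nonneg)
      finally show ?thesis by (simp add: K_def mult_ac)
    qed
    have "\<bar>y $ j - u $ j\<bar> \<le> \<kappa> * \<delta>" for j
    proof -
      have "\<bar>y $ j - u $ j\<bar> = \<bar>\<Sum>g\<in>G S P. l g * g $ j\<bar>"
        using arg_cong[OF yu, of "\<lambda>v. v $ j"] by simp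
      also have "\<dots> \<le> (\<Sum>g\<in>G S P. l g * \<bar>g $ j\<bar>)"
        using l by (intro order_trans[OF sum_abs] sum_mono) (simp add: abs_mult)
      also have "\<dots> \<le> (\<Sum>g\<in>G S P. K g * \<delta>)" by (intro sum_mono bound)
      also have "\<dots> \<le> (\<Sum>g\<in>(\<Union>S P. G S P). K g * \<delta>)"
        using fin K \<delta>0 by (intro sum_mono2) auto
      finally show ?thesis by (simp add: \<kappa>_def sum_distrib_right)
    qed
    with y show "\<exists>y. lp_optimal A r b d' y \<and> (\<forall>j. \<bar>y $ j - u $ j\<bar> \<le> \<kappa> * \<delta>)" by blast
  qed
qed

section \<open>The value of the linear program under one decision\<close>

definition lp_value :: "real^'n^'m \<Rightarrow> real^'n \<Rightarrow> real^'m \<Rightarrow> real^'n \<Rightarrow> real" where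
  "lp_value A r b d = (SUP y\<in>{y. lp_feasible A b d y}. r \<bullet> y)"

lemma lp_value_eq: "lp_optimal A r b d y \<Longrightarrow> lp_value A r b d = r \<bullet> y"
  unfolding lp_value_def by (rule cSup_eq_maximum) (auto simp: lp_optimal_iff)

lemma lp_feasible_le_value:
  assumes "lp_feasible A b d z"
  shows "r \<bullet> z \<le> lp_value A r b d"
proof -
  obtain y where "lp_optimal A r b d y" using lp_optimal_exists[OF assms] .
  then show ?thesis using assms by (auto simp: lp_value_eq lp_optimal_iff)
qed

definition consumed :: "real^'n^'m \<Rightarrow> bool \<Rightarrow> 'n \<Rightarrow> real^'m" where
  "consumed A x j = (if x then column j A else 0)"

definition earned :: "real^'n \<Rightarrow> bool \<Rightarrow> 'n \<Rightarrow> real" where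
  "earned r x j = (if x then r $ j else 0)"

lemma consumed_eq_mult: "consumed A x j = A *v (if x then axis j 1 else 0)"
  by (simp add: consumed_def matrix_vector_mult_basis)

lemma earned_eq_inner: "earned r x j = r \<bullet> (if x then axis j 1 else 0)"
  by (simp add: earned_def inner_axis)

text \<open>\<open>v\<close> holds the later arrivals and \<open>j\<close> is the current one. An
  optimal plan for the later arrivals together with the current decision is feasible in
  hindsight.\<close>

lemma lp_value_step_upper:
  fixes A :: "real^'n^'m"
  assumes "0 \<le> b - consumed A x j" "0 \<le> v"
  shows "earned r x j + lp_value A r (b - consumed A x j) v \<le> lp_value A r b (v + axis j 1)"
proof -
  let ?e = "if x then axis j 1 else 0 :: real^'n"
  have "lp_feasible A (b - consumed A x j) v 0" using assms by (simp add: lp_feasible_def)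
  then obtain y where y: "lp_optimal A r (b - consumed A x j) v y" by (rule lp_optimal_exists)
  then have f: "A *v y \<le> b - A *v ?e" "0 \<le> y" "y \<le> v"
    unfolding consumed_eq_mult by (auto simp: lp_optimal_iff lp_feasible_def)
  have e: "0 \<le> ?e" "?e \<le> axis j 1" by (auto simp: less_eq_vec_def axis_def)
  have "0 \<le> y + ?e" "y + ?e \<le> v + axis j 1"
    by (rule add_nonneg_nonneg[OF f(2) e(1)], rule add_mono[OF f(3) e(2)])
  with f have "lp_feasible A b (v + axis j 1) (y + ?e)"
    unfolding lp_feasible_def matrix_vector_right_distrib le_diff_eq by simp
  from lp_feasible_le_value[OF this, of r] show ?thesis
    by (simp add: lp_value_eq[OF y] inner_add_right earned_eq_inner)
qed

text \<open>Nothing is lost once some optimal hindsight plan can follow the decision: acceptance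
  takes one unit off \<open>y\<close>, rejection needs \<open>y\<close> to fit the later arrivals
  alone.\<close>

lemma lp_value_step_lossless:
  fixes A :: "real^'n^'m"
  assumes y: "lp_optimal A r b (v + axis j 1) y"
    and "x \<Longrightarrow> 1 \<le> y $ j" "\<not> x \<Longrightarrow> y $ j \<le> v $ j"
  shows "lp_value A r b (v + axis j 1) \<le> earned r x j + lp_value A r (b - consumed A x j) v"
proof -
  let ?e = "if x then axis j 1 else 0 :: real^'n"
  have f: "A *v y \<le> b" "\<And>i. 0 \<le> y $ i" "\<And>i. y $ i \<le> v $ i + axis j 1 $ i"
    using y by (auto simp: lp_optimal_iff lp_feasible_def less_eq_vec_def)
  have "0 \<le> (y - ?e) $ i \<and> (y - ?e) $ i \<le> v $ i" for i
    using assms(2,3) f(2,3)[of i] by (cases "i = j") (auto simp: axis_def)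
  moreover have "A *v (y - ?e) \<le> b - consumed A x j"
    using f(1) by (simp add: consumed_eq_mult matrix_vector_mult_diff_distrib)
  ultimately have "lp_feasible A (b - consumed A x j) v (y - ?e)"
    unfolding lp_feasible_def by (simp add: less_eq_vec_def)
  from lp_feasible_le_value[OF this, of r] show ?thesis
    by (simp add: lp_value_eq[OF y] inner_diff_right earned_eq_inner)
qed

text \<open>
  Lowering every coordinate of an optimal solution by the constant \<open>c\<close>, down to at most zero,
  frees as much of each resource as one customer can consume, or else empties its use completely.
\<close>

lemma lp_value_step_bounded:
  fixes A :: "real^'n^'m" and r :: "real^'n"
  assumes r: "\<And>j. 0 \<le> r $ j" and A: "\<And>i j. 0 \<le> A $ i $ j"
  obtains M where "0 \<le> M"
    "\<And>b v x j. 0 \<le> b - consumed A x j \<Longrightarrow> 0 \<le> v \<Longrightarrow>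
      lp_value A r b (v + axis j 1) \<le> earned r x j + lp_value A r (b - consumed A x j) v + M"
proof -
  \<comment> \<open>Dominates every ratio of two entries of a row, where division by zero gives 0;
    the added 1 covers the unit by which the demand bound of type \<open>j\<close> drops.\<close>
  define c where "c = 1 + (\<Sum>i\<in>UNIV. \<Sum>j\<in>UNIV. \<Sum>l\<in>UNIV. A $ i $ j / A $ i $ l)"
  have c: "A $ i $ j / A $ i $ l \<le> c" "1 \<le> c" for i j l
  proof -
    have "A $ i $ j / A $ i $ l \<le> (\<Sum>l\<in>UNIV. A $ i $ j / A $ i $ l)"
      by (rule member_le_sum) (auto simp: A)
    also have "\<dots> \<le> (\<Sum>j\<in>UNIV. \<Sum>l\<in>UNIV. A $ i $ j / A $ i $ l)"
      by (rule member_le_sum) (auto simp: A sum_nonneg)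
    also have "\<dots> \<le> (\<Sum>i\<in>UNIV. \<Sum>j\<in>UNIV. \<Sum>l\<in>UNIV. A $ i $ j / A $ i $ l)"
      by (rule member_le_sum) (auto simp: A sum_nonneg)
    finally show "A $ i $ j / A $ i $ l \<le> c" by (simp add: c_def)
    show "1 \<le> c" by (simp add: c_def A sum_nonneg)
  qed
  show thesis
  proof
    show "0 \<le> c * (\<Sum>l\<in>UNIV. r $ l)" using c(2) r by (simp add: sum_nonneg)
    fix b :: "real^'m" and v :: "real^'n" and x j
    assume b: "0 \<le> b - consumed A x j" and v: "0 \<le> v"
    have cons: "0 \<le> consumed A x j $ i" "consumed A x j $ i \<le> A $ i $ j" for i
      by (auto simp: consumed_def column_def A)
    have b0: "0 \<le> b $ i - consumed A x j $ i" for i using b by (simp add: less_eq_vec_def)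
    have "lp_feasible A b (v + axis j 1) 0"
      using b0 cons v by (auto simp: lp_feasible_def less_eq_vec_def axis_def) (smt (verit))
    then obtain y where y: "lp_optimal A r b (v + axis j 1) y" by (rule lp_optimal_exists)
    then have f: "\<And>i. (A *v y) $ i \<le> b $ i" "\<And>i. 0 \<le> y $ i" "\<And>i. y $ i \<le> v $ i + axis j 1 $ i"
      by (auto simp: lp_optimal_iff lp_feasible_def less_eq_vec_def)
    define z where "z = (\<chi> l. max (y $ l - c) 0)"
    have z: "0 \<le> z $ l" "z $ l \<le> y $ l" "y $ l - z $ l \<le> c" for l
      using f(2)[of l] c(2) by (auto simp: z_def)
    have zv: "z $ l \<le> v $ l" for l
    proof -
      have "y $ l \<le> v $ l + 1" "0 \<le> v $ l"
        using f(3)[of l] v by (auto simp: axis_def less_eq_vec_def split: if_splits)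
      then show ?thesis using c(2) by (simp add: z_def)
    qed
    \<comment> \<open>If a type using resource \<open>i\<close> has level at least \<open>c\<close>,
      lowering it frees \<open>A $ i $ j\<close>; otherwise all users of the resource are lowered to
      zero.\<close>
    have Az: "(A *v z) $ i \<le> b $ i - consumed A x j $ i" for i
    proof (cases "\<exists>l. A $ i $ l > 0 \<and> c \<le> y $ l")
      case True
      then obtain l where l: "A $ i $ l > 0" "c \<le> y $ l" by blast
      have "A $ i $ j \<le> A $ i $ l * c" using c(1)[of i j l] l by (simp add: field_simps)
      also have "\<dots> = A $ i $ l * (y $ l - z $ l)" using l by (simp add: z_def)
      also have "\<dots> \<le> (\<Sum>l\<in>UNIV. A $ i $ l * (y $ l - z $ l))"
        by (rule member_le_sum) (auto simp: A z)
      also have "\<dots> = (A *v y) $ i - (A *v z) $ i"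
        by (simp add: matrix_vector_mult_def algebra_simps sum_subtractf)
      finally show ?thesis using f(1)[of i] cons(2)[of i] by linarith
    next
      case False
      then have zero: "A $ i $ l * z $ l = 0" for l
        using A[of i l] by (cases "A $ i $ l > 0") (auto simp: z_def not_le)
      have "(A *v z) $ i = 0"
        unfolding matrix_vector_mult_def vec_lambda_beta by (intro sum.neutral ballI zero)
      then show ?thesis using b0[of i] by simp
    qed
    have "lp_feasible A (b - consumed A x j) v z"
      using Az zv z by (simp add: lp_feasible_def less_eq_vec_def)
    then have "r \<bullet> z \<le> lp_value A r (b - consumed A x j) v" by (rule lp_feasible_le_value)
    moreover have "r \<bullet> y \<le> r \<bullet> z + c * (\<Sum>l\<in>UNIV. r $ l)"
    proof -
      have "r \<bullet> y - r \<bullet> z = (\<Sum>l\<in>UNIV. r $ l * (y $ l - z $ l))"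
        by (simp add: inner_vec_def algebra_simps sum_subtractf)
      also have "\<dots> \<le> (\<Sum>l\<in>UNIV. r $ l * c)"
        by (intro sum_mono mult_left_mono z r)
      finally show ?thesis by (simp add: sum_distrib_left mult_ac)
    qed
    moreover have "0 \<le> earned r x j" by (simp add: earned_def r)
    ultimately show "lp_value A r b (v + axis j 1) \<le>
        earned r x j + lp_value A r (b - consumed A x j) v + c * (\<Sum>l\<in>UNIV. r $ l)"
      by (simp add: lp_value_eq[OF y])
  qed
qed

section \<open>Random arrivals and the hindsight value\<close>

lemma expectation_bind_finite:
  fixes f :: "'a \<Rightarrow> 'b pmf" and h :: "'b \<Rightarrow> real"
  assumes "finite (set_pmf M)" "\<And>x. x \<in> set_pmf M \<Longrightarrow> finite (set_pmf (f x))"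
  shows "measure_pmf.expectation (bind_pmf M f) h =
    measure_pmf.expectation M (\<lambda>x. measure_pmf.expectation (f x) h)"
  using pmf_expectation_bind[OF assms subset_refl, where h = h]
  by (simp add: integral_measure_pmf[OF assms(1), where f = "\<lambda>x. measure_pmf.expectation (f x) h"])

lemma expectation_mono_finite:
  fixes f g :: "'a \<Rightarrow> real"
  assumes "finite (set_pmf M)" "\<And>x. x \<in> set_pmf M \<Longrightarrow> f x \<le> g x"
  shows "measure_pmf.expectation M f \<le> measure_pmf.expectation M g"
  using assms by (intro integral_mono_AE integrable_measure_pmf_finite) (auto simp: AE_measure_pmf_iff)

lemma expectation_add_finite:
  fixes f g :: "'a \<Rightarrow> real"
  assumes "finite (set_pmf M)"
  shows "measure_pmf.expectation M (\<lambda>x. f x + g x) = measure_pmf.expectation M f + measure_pmf.expectation M g"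
  using assms by (intro Bochner_Integration.integral_add integrable_measure_pmf_finite)

section \<open>Multinomial demand and its concentration\<close>

text \<open>The multinomial law of type counts, built one arrival at a time so that the current
  customer can be split off.\<close>

primrec demand :: "'n::finite pmf \<Rightarrow> nat \<Rightarrow> (real^'n) pmf" where
  "demand p 0 = return_pmf 0"
| "demand p (Suc n) = bind_pmf p (\<lambda>j. bind_pmf (demand p n) (\<lambda>v. return_pmf (v + axis j 1)))"

lemma finite_demand [simp]: "finite (set_pmf (demand p n))"
  by (induction n) auto

lemma demand_nonneg: "v \<in> set_pmf (demand p n) \<Longrightarrow> 0 \<le> v"
  by (induction n arbitrary: v) (auto simp: less_eq_vec_def axis_def)

lemma expectation_demand_Suc:
  "measure_pmf.expectation (demand p (Suc n)) (f :: _ \<Rightarrow> real) =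
   measure_pmf.expectation p (\<lambda>j. measure_pmf.expectation (demand p n) (\<lambda>v. f (v + axis j 1)))"
  by (simp add: expectation_bind_finite)

lemma map_pmf_eq_bernoulli: "map_pmf (\<lambda>j. j = i) p = bernoulli_pmf (pmf p i)"
proof (rule pmf_eqI)
  fix b
  have T: "pmf (map_pmf (\<lambda>j. j = i) p) True = pmf p i"
    by (simp add: pmf_map vimage_def measure_pmf_single)
  have "(\<Sum>b\<in>UNIV. pmf (map_pmf (\<lambda>j. j = i) p) b) = 1"
    by (rule sum_pmf_eq_1) auto
  then have "pmf (map_pmf (\<lambda>j. j = i) p) False = 1 - pmf p i" using T by (simp add: UNIV_bool)
  then show "pmf (map_pmf (\<lambda>j. j = i) p) b = pmf (bernoulli_pmf (pmf p i)) b"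
    using T by (cases b) (auto simp: pmf_le_1)
qed

text \<open>Counting a single type gives Bernoulli trials, which makes Hoeffding's inequality for
  the binomial distribution available.\<close>

lemma demand_binomial:
  "map_pmf (\<lambda>v. v $ i) (demand p n) = map_pmf real (binomial_pmf n (pmf p i))"
proof (induction n)
  case 0
  then show ?case by (simp add: binomial_pmf_0 pmf_le_1)
next
  case (Suc n)
  have "map_pmf (\<lambda>v. v $ i) (demand p (Suc n)) =
      bind_pmf p (\<lambda>j. bind_pmf (demand p n) (\<lambda>v. return_pmf ((if j = i then 1 else 0) + v $ i)))"
    by (auto simp: map_bind_pmf axis_def add.commute intro!: bind_pmf_cong)
  also have "\<dots> = bind_pmf (map_pmf (\<lambda>j. j = i) p) (\<lambda>b.
      bind_pmf (map_pmf (\<lambda>v. v $ i) (demand p n)) (\<lambda>a. return_pmf ((if b then 1 else 0) + a)))"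
    by (simp add: bind_map_pmf)
  also have "\<dots> = map_pmf real (binomial_pmf (Suc n) (pmf p i))"
    unfolding Suc.IH map_pmf_eq_bernoulli
    by (auto simp: binomial_pmf_Suc pmf_le_1 map_bind_pmf bind_map_pmf intro!: bind_pmf_cong)
  finally show ?case .
qed

text \<open>Weakened from \<open>n\<close> to \<open>N\<close> so that one exponent serves both the
  arrivals since the last re-solving and those still to come.\<close>

lemma demand_concentration:
  assumes "n \<le> N" "0 < \<epsilon>"
  shows "measure_pmf.prob (demand p n) {v. \<epsilon> \<le> \<bar>v $ i - real n * pmf p i\<bar>} \<le> 2 * exp (- (2 * \<epsilon>\<^sup>2 / real N))"
proof (cases "n = 0")
  case True
  then show ?thesis using assms(2) by (simp add: indicator_def)
next
  case False
  interpret binomial_distribution n "pmf p i" by unfold_locales (simp add: pmf_le_1)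
  have "measure_pmf.prob (demand p n) {v. \<epsilon> \<le> \<bar>v $ i - real n * pmf p i\<bar>} =
      measure_pmf.prob (map_pmf (\<lambda>v. v $ i) (demand p n)) {a. \<epsilon> \<le> \<bar>a - real n * pmf p i\<bar>}"
    by (simp add: vimage_def)
  also have "\<dots> = measure_pmf.prob (binomial_pmf n (pmf p i)) {a. \<epsilon> \<le> \<bar>real a - real n * pmf p i\<bar>}"
    unfolding demand_binomial by (simp add: vimage_def)
  also have "\<dots> \<le> 2 * exp (- 2 * \<epsilon>\<^sup>2 / real n)"
    using prob_abs_ge[of \<epsilon>] False assms(2) by simp
  also have "\<dots> \<le> 2 * exp (- (2 * \<epsilon>\<^sup>2 / real N))"
    using assms False by (simp add: divide_left_mono)
  finally show ?thesis .
qed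

section \<open>Arrivals along a trajectory\<close>

definition arrivals :: "'n::finite history \<Rightarrow> real^'n" where
  "arrivals h = (\<Sum>e\<leftarrow>h. axis (fst e) 1)"

lemma arrivals_simps [simp]:
  "arrivals [] = 0" "arrivals (e # h) = axis (fst e) 1 + arrivals h"
  by (simp_all add: arrivals_def)

lemma finite_trajectory [simp]:
  fixes p :: "'n::finite pmf"
  shows "finite (set_pmf (trajectory p \<mu> t))"
  by (induction t) auto

lemma length_trajectory: "h \<in> set_pmf (trajectory p \<mu> t) \<Longrightarrow> length h = t"
  by (induction t arbitrary: h) auto

text \<open>Types are drawn independently of past decisions, so the latest \<open>k\<close> arrivals
  have the same law under every policy.\<close>

lemma recent_arrivals_trajectory:
  "map_pmf (\<lambda>h. arrivals (take k h)) (trajectory p \<mu> (s + k)) = demand p k"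
proof (induction k)
  case 0
  then show ?case by (simp add: map_pmf_const)
next
  case (Suc k)
  have "map_pmf (\<lambda>h. arrivals (take (Suc k) h)) (trajectory p \<mu> (s + Suc k)) =
      bind_pmf (trajectory p \<mu> (s + k)) (\<lambda>h. bind_pmf p (\<lambda>j. return_pmf (arrivals (take k h) + axis j 1)))"
    by (simp add: map_bind_pmf add.commute)
  \<comment> \<open>The newest type is independent of the history and may be drawn first, as in the
    recursion of \<open>demand\<close>.\<close>
  also have "\<dots> = bind_pmf p (\<lambda>j. bind_pmf (trajectory p \<mu> (s + k)) (\<lambda>h.
      return_pmf (arrivals (take k h) + axis j 1)))"
    by (rule bind_commute_pmf)
  also have "\<dots> = bind_pmf p (\<lambda>j. bind_pmf (map_pmf (\<lambda>h. arrivals (take k h)) (trajectory p \<mu> (s + k)))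
      (\<lambda>v. return_pmf (v + axis j 1)))"
    by (simp add: bind_map_pmf)
  finally show ?case by (simp add: Suc.IH)
qed

text \<open>The potential: the clairvoyant bound at \<open>t = 0\<close>, and at
  \<open>t = T\<close> the expected reward of a policy that respects the inventory.\<close>

definition hindsight_value ::
    "real^'n^'m \<Rightarrow> real^'n \<Rightarrow> real^'m \<Rightarrow> 'n::finite pmf \<Rightarrow> nat \<Rightarrow> 'n policy \<Rightarrow> nat \<Rightarrow> real" where
  "hindsight_value A r B p T \<mu> t = measure_pmf.expectation (trajectory p \<mu> t)
     (\<lambda>h. collected r h + measure_pmf.expectation (demand p (T - t)) (lp_value A r (inventory A B h)))"

text \<open>Both values become averages over the same history, current type and later demand, so
  that comparing them reduces to pointwise inequalities for \<open>lp_value\<close>.\<close>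

lemma hindsight_value_step:
  assumes "t < T"
  shows "hindsight_value A r B p T \<mu> t = measure_pmf.expectation (trajectory p \<mu> t) (\<lambda>h.
      measure_pmf.expectation p (\<lambda>j. measure_pmf.expectation (demand p (T - Suc t)) (\<lambda>v.
        collected r h + lp_value A r (inventory A B h) (v + axis j 1))))"
    and "hindsight_value A r B p T \<mu> (Suc t) = measure_pmf.expectation (trajectory p \<mu> t) (\<lambda>h.
      measure_pmf.expectation p (\<lambda>j. measure_pmf.expectation (\<mu> h j) (\<lambda>x.
        measure_pmf.expectation (demand p (T - Suc t)) (\<lambda>v.
        collected r h + (earned r x j + lp_value A r (inventory A B h - consumed A x j) v)))))"
proof -
  have T: "T - t = Suc (T - Suc t)" using assms by simp
  show "hindsight_value A r B p T \<mu> t = measure_pmf.expectation (trajectory p \<mu> t) (\<lambda>h.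
      measure_pmf.expectation p (\<lambda>j. measure_pmf.expectation (demand p (T - Suc t)) (\<lambda>v.
        collected r h + lp_value A r (inventory A B h) (v + axis j 1))))"
    unfolding hindsight_value_def T expectation_demand_Suc by (simp add: expectation_add_finite)
  show "hindsight_value A r B p T \<mu> (Suc t) = measure_pmf.expectation (trajectory p \<mu> t) (\<lambda>h.
      measure_pmf.expectation p (\<lambda>j. measure_pmf.expectation (\<mu> h j) (\<lambda>x.
        measure_pmf.expectation (demand p (T - Suc t)) (\<lambda>v.
        collected r h + (earned r x j + lp_value A r (inventory A B h - consumed A x j) v)))))"
    by (simp add: hindsight_value_def expectation_bind_finite expectation_add_finite consumed_def
        earned_def add.assoc cong: if_cong)
qed

lemma hindsight_value_Suc_le:
  fixes A :: "real^'n^'m"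
  assumes "t < T"
    and feas: "\<And>h. h \<in> set_pmf (trajectory p \<mu> (Suc t)) \<Longrightarrow> 0 \<le> inventory A B h"
  shows "hindsight_value A r B p T \<mu> (Suc t) \<le> hindsight_value A r B p T \<mu> t"
  unfolding hindsight_value_step[OF assms(1)]
proof (intro expectation_mono_finite)
  fix h j assume h: "h \<in> set_pmf (trajectory p \<mu> t)" and j: "j \<in> set_pmf p"
  let ?R = "measure_pmf.expectation (demand p (T - Suc t)) (\<lambda>v.
        collected r h + lp_value A r (inventory A B h) (v + axis j 1))"
  have "measure_pmf.expectation (\<mu> h j) (\<lambda>x. measure_pmf.expectation (demand p (T - Suc t)) (\<lambda>v.
        collected r h + (earned r x j + lp_value A r (inventory A B h - consumed A x j) v)))
      \<le> measure_pmf.expectation (\<mu> h j) (\<lambda>x. ?R)"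
  proof (intro expectation_mono_finite add_left_mono lp_value_step_upper)
    fix x assume "x \<in> set_pmf (\<mu> h j)"
    with h j have "(j, x) # h \<in> set_pmf (trajectory p \<mu> (Suc t))" by auto
    from feas[OF this] show "0 \<le> inventory A B h - consumed A x j"
      by (simp add: consumed_def cong: if_cong)
  qed (auto simp: demand_nonneg)
  then show "measure_pmf.expectation (\<mu> h j) (\<lambda>x. measure_pmf.expectation (demand p (T - Suc t)) (\<lambda>v.
        collected r h + (earned r x j + lp_value A r (inventory A B h - consumed A x j) v))) \<le> ?R"
    by simp
qed auto

text \<open>The loss is split into a past and a future part so that each is averaged under its own
  law; with \<open>j\<close> averaged out, \<open>v + axis j 1\<close> is the demand of
  \<open>T - t\<close> periods.\<close>

lemma hindsight_value_le_Suc: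
  fixes A :: "real^'n^'m" and dec :: "'n history \<Rightarrow> 'n \<Rightarrow> bool"
  assumes "t < T" and \<mu>: "\<And>h j. \<mu> h j = return_pmf (dec h j)"
    and loss: "\<And>h j v. h \<in> set_pmf (trajectory p \<mu> t) \<Longrightarrow> v \<in> set_pmf (demand p (T - Suc t)) \<Longrightarrow>
      lp_value A r (inventory A B h) (v + axis j 1) \<le>
      earned r (dec h j) j + lp_value A r (inventory A B h - consumed A (dec h j) j) v
        + (f h + g (v + axis j 1))"
  shows "hindsight_value A r B p T \<mu> t \<le> hindsight_value A r B p T \<mu> (Suc t) +
    (measure_pmf.expectation (trajectory p \<mu> t) f + measure_pmf.expectation (demand p (T - t)) g)"
proof -
  have T: "T - t = Suc (T - Suc t)" using assms by simp
  have "hindsight_value A r B p T \<mu> t \<le> measure_pmf.expectation (trajectory p \<mu> t) (\<lambda>h.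
      measure_pmf.expectation p (\<lambda>j. measure_pmf.expectation (demand p (T - Suc t)) (\<lambda>v.
        (collected r h + (earned r (dec h j) j + lp_value A r (inventory A B h - consumed A (dec h j) j) v))
         + (f h + g (v + axis j 1)))))"
    unfolding hindsight_value_step[OF assms(1)]
    by (intro expectation_mono_finite) (use loss in \<open>auto simp: algebra_simps\<close>)
  also have "\<dots> = hindsight_value A r B p T \<mu> (Suc t) +
    (measure_pmf.expectation (trajectory p \<mu> t) f + measure_pmf.expectation (demand p (T - t)) g)"
    unfolding hindsight_value_step(2)[OF assms(1)] T expectation_demand_Suc
    by (simp add: expectation_add_finite \<mu>)
  finally show ?thesis .
qed

lemma hindsight_value_0 [simp]:
  "hindsight_value A r B p T \<mu> 0 = measure_pmf.expectation (demand p T) (lp_value A r B)"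
  by (simp add: hindsight_value_def)

lemma hindsight_value_final:
  assumes "\<And>h. h \<in> set_pmf (trajectory p \<mu> T) \<Longrightarrow> 0 \<le> inventory A B h"
  shows "hindsight_value A r B p T \<mu> T = measure_pmf.expectation (trajectory p \<mu> T) (collected r)"
proof -
  have "lp_value A r b 0 = 0" if b: "0 \<le> b" for b
  proof -
    have "lp_optimal A r b 0 0"
      using b by (auto simp: lp_optimal_iff lp_feasible_def dest!: antisym)
    then show ?thesis by (simp add: lp_value_eq)
  qed
  then show ?thesis
    unfolding hindsight_value_def using assms
    by (intro integral_cong_AE) (auto simp: AE_measure_pmf_iff)
qed

section \<open>Decisions of the AIR-KP policy\<close>

definition air_kp_accepts ::
    "real^'n^'m \<Rightarrow> real^'m \<Rightarrow> 'n pmf \<Rightarrow> nat \<Rightarrow> nat set \<Rightarrow> ('n history \<Rightarrow> real^'n) \<Rightarrow> 'n history \<Rightarrow> 'n \<Rightarrow> bool" where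
  "air_kp_accepts A \<rho> p T R sel h j \<longleftrightarrow>
     (let (u, d) = air_kp_plan p T R sel h
      in column j A \<le> inventory A (real T *\<^sub>R \<rho>) h \<and> u $ j > 1 \<and> u $ j \<ge> d $ j - u $ j)"

lemma air_kp_eq_return: "air_kp A \<rho> p T R sel h j = return_pmf (air_kp_accepts A \<rho> p T R sel h j)"
  by (simp add: air_kp_def air_kp_accepts_def split: prod.split)

lemma trajectory_air_kp_Suc:
  assumes "h \<in> set_pmf (trajectory p (air_kp A \<rho> p T R sel) (Suc t))"
  obtains h' j where "h' \<in> set_pmf (trajectory p (air_kp A \<rho> p T R sel) t)"
    "h = (j, air_kp_accepts A \<rho> p T R sel h' j) # h'"
  using assms by (auto simp: air_kp_eq_return)

lemma inventory_Cons: "inventory A B (e # h) = inventory A B h - consumed A (snd e) (fst e)"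
  by (simp add: consumed_def)

lemma air_kp_inventory_nonneg:
  fixes A :: "real^'n^'m"
  assumes "\<And>i. 0 \<le> \<rho> $ i"
    and "h \<in> set_pmf (trajectory p (air_kp A \<rho> p T R sel) t)"
  shows "0 \<le> inventory A (real T *\<^sub>R \<rho>) h"
  using assms(2)
proof (induction t arbitrary: h)
  case 0
  then show ?case using assms(1) by (simp add: less_eq_vec_def)
next
  case (Suc t)
  from Suc.prems obtain h' j where h: "h' \<in> set_pmf (trajectory p (air_kp A \<rho> p T R sel) t)"
    "h = (j, air_kp_accepts A \<rho> p T R sel h' j) # h'"
    by (rule trajectory_air_kp_Suc)
  with Suc.IH[OF h(1)] show ?case by (auto simp: air_kp_accepts_def split: prod.splits)
qed

text \<open>A better plan for the reduced program would, with the accepted unit put back, beat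
  \<open>u\<close>. The two margins keep the continued plan feasible.\<close>

lemma lp_optimal_step:
  fixes A :: "real^'n^'m"
  assumes u: "lp_optimal A r b d u" and acc: "x \<Longrightarrow> 1 \<le> u $ j" and rej: "\<not> x \<Longrightarrow> 1 \<le> d $ j - u $ j"
  shows "lp_optimal A r (b - consumed A x j) (d - axis j 1) (u - (if x then axis j 1 else 0))"
proof -
  let ?e = "if x then axis j 1 else 0 :: real^'n"
  have f: "A *v u \<le> b" "\<And>i. 0 \<le> u $ i" "\<And>i. u $ i \<le> d $ i"
    using u by (auto simp: lp_optimal_iff lp_feasible_def less_eq_vec_def)
  have "0 \<le> (u - ?e) $ i \<and> (u - ?e) $ i \<le> (d - axis j 1) $ i" for i
    using acc rej f(2,3)[of i] by (cases "i = j") (auto simp: axis_def)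
  moreover have "A *v (u - ?e) \<le> b - consumed A x j"
    using f(1) by (simp add: consumed_eq_mult matrix_vector_mult_diff_distrib)
  ultimately have "lp_feasible A (b - consumed A x j) (d - axis j 1) (u - ?e)"
    unfolding lp_feasible_def by (simp add: less_eq_vec_def)
  moreover have "r \<bullet> z \<le> r \<bullet> (u - ?e)" if z: "lp_feasible A (b - consumed A x j) (d - axis j 1) z" for z
  proof -
    have e: "0 \<le> ?e" "?e \<le> axis j 1" by (auto simp: less_eq_vec_def axis_def)
    have zf: "A *v z \<le> b - A *v ?e" "0 \<le> z" "z \<le> d - axis j 1"
      using z unfolding lp_feasible_def consumed_eq_mult by auto
    have "0 \<le> z + ?e" by (rule add_nonneg_nonneg[OF zf(2) e(1)])
    moreover have "z + ?e \<le> d" using add_mono[OF zf(3) e(2)] by (simp del: if_split)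
    ultimately have "lp_feasible A b d (z + ?e)"
      using zf(1) unfolding lp_feasible_def matrix_vector_right_distrib le_diff_eq by simp
    then have "r \<bullet> (z + ?e) \<le> r \<bullet> u" using u unfolding lp_optimal_iff by blast
    then show ?thesis unfolding inner_add_right inner_diff_right by linarith
  qed
  ultimately show ?thesis unfolding lp_optimal_iff by blast
qed

text \<open>With nonnegative entries, one unit of type \<open>j\<close> uses no more than the whole
  plan. This traces a rejection to the tests on \<open>u\<close>.\<close>

lemma column_le_of_feasible:
  fixes A :: "real^'n^'m"
  assumes A: "\<And>i j. 0 \<le> A $ i $ j" and "lp_feasible A b d u" "1 \<le> u $ j"
  shows "column j A \<le> b"
proof -
  have f: "\<And>i. (A *v u) $ i \<le> b $ i" "\<And>i. 0 \<le> u $ i"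
    using assms(2) by (auto simp: lp_feasible_def less_eq_vec_def)
  have "A $ i $ j \<le> b $ i" for i
  proof -
    have "A $ i $ j \<le> A $ i $ j * u $ j" using mult_left_mono[OF assms(3) A[of i j]] by simp
    also have "\<dots> \<le> (\<Sum>k\<in>UNIV. A $ i $ k * u $ k)"
      by (rule member_le_sum) (auto simp: A f)
    also have "\<dots> = (A *v u) $ i" by (simp add: matrix_vector_mult_def)
    finally show ?thesis using f(1)[of i] by linarith
  qed
  then show ?thesis by (simp add: less_eq_vec_def column_def)
qed

text \<open>A rejection means \<open>u $ j \<le> 1\<close> or \<open>u $ j < d $ j / 2\<close>, and
  1 is at most \<open>d $ j / 2\<close> here.\<close>

lemma air_kp_reject_slack:
  fixes A :: "real^'n^'m"
  assumes A: "\<And>i j. 0 \<le> A $ i $ j"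
    and plan: "air_kp_plan p T R sel h = (u, d)"
    and "lp_feasible A (inventory A (real T *\<^sub>R \<rho>) h) d u"
    and "2 \<le> d $ j" "\<not> air_kp_accepts A \<rho> p T R sel h j"
  shows "d $ j / 2 \<le> d $ j - u $ j"
  using assms(4,5) column_le_of_feasible[OF A assms(3), of j] by (auto simp: air_kp_accepts_def plan)

text \<open>
  The bound \<open>1 \<le> d $ j\<close> is essential: once \<open>d $ j\<close> is small, rejecting a customer can
  push \<open>d $ j\<close> below \<open>u $ j\<close>. Within an epoch \<open>d\<close> only decreases, so the bound at
  the current period implies it at all earlier periods of the epoch.
\<close>

lemma air_kp_plan_optimal:
  fixes A :: "real^'n^'m"
  assumes A: "\<And>i j. 0 \<le> A $ i $ j" and \<rho>: "\<And>i. 0 \<le> \<rho> $ i"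
    and sel: "optimal_selection A r \<rho> p T R sel" and R: "1 \<in> R"
    and "h \<in> set_pmf (trajectory p (air_kp A \<rho> p T R sel) t)"
    and "air_kp_plan p T R sel h = (u, d)" "\<And>j. 1 \<le> d $ j"
  shows "lp_optimal A r (inventory A (real T *\<^sub>R \<rho>) h) d u"
  using assms(5-)
proof (induction t arbitrary: h u d)
  case 0
  have "0 \<le> inventory A (real T *\<^sub>R \<rho>) h"
    by (rule air_kp_inventory_nonneg[where p = p and t = 0 and sel = sel and R = R, OF \<rho>]) (use 0 in simp)
  moreover have "u = sel h" "d = remaining_demand p T h" "Suc (length h) \<in> R"
    using 0 R by (auto simp: resolve_def)
  ultimately show ?case using sel by (simp add: optimal_selection_def)
next
  case (Suc t)
  from Suc.prems(1) obtain h' j where h: "h' \<in> set_pmf (trajectory p (air_kp A \<rho> p T R sel) t)"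
    "h = (j, air_kp_accepts A \<rho> p T R sel h' j) # h'"
    by (rule trajectory_air_kp_Suc)
  let ?x = "air_kp_accepts A \<rho> p T R sel h' j"
  show ?case
  proof (cases "Suc (length h) \<in> R")
    case True
    have "0 \<le> inventory A (real T *\<^sub>R \<rho>) h" by (rule air_kp_inventory_nonneg[OF \<rho> Suc.prems(1)])
    moreover have "u = sel h" "d = remaining_demand p T h"
      using True Suc.prems(2) by (auto simp: h(2) resolve_def)
    ultimately show ?thesis using sel True by (simp add: optimal_selection_def)
  next
    case False
    obtain u' d' where plan': "air_kp_plan p T R sel h' = (u', d')" by force
    have ud: "u = u' - (if ?x then axis j 1 else 0)" "d = d' - axis j 1"
      using False Suc.prems(2) by (auto simp: h(2) resolve_def plan')
    have d1: "1 \<le> d' $ i" for i using Suc.prems(3)[of i] by (auto simp: ud axis_def split: if_splits)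
    \<comment> \<open>Before this arrival the bound of type \<open>j\<close> was larger by one,
      which is what the rejection estimate requires.\<close>
    have d2: "2 \<le> d' $ j" using Suc.prems(3)[of j] by (simp add: ud)
    have opt: "lp_optimal A r (inventory A (real T *\<^sub>R \<rho>) h') d' u'"
      by (rule Suc.IH[OF h(1) plan' d1])
    then have feas: "lp_feasible A (inventory A (real T *\<^sub>R \<rho>) h') d' u'" by (simp add: lp_optimal_iff)
    have "1 \<le> d' $ j - u' $ j" if "\<not> ?x"
      using air_kp_reject_slack[OF A plan' feas d2 that] d2 by simp
    moreover have "1 \<le> u' $ j" if ?x using that by (simp add: air_kp_accepts_def plan')
    ultimately show ?thesis
      using lp_optimal_step[OF opt, of ?x j] unfolding h(2) inventory_Cons ud by simp
  qed
qed

text \<open>Histories list recent periods first, so \<open>take\<close> selects the arrivals since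
  the last re-solving, which took place in period \<open>Suc s\<close> at history length
  \<open>s\<close>.\<close>

lemma air_kp_plan_demand:
  fixes p :: "'n::finite pmf"
  assumes "Suc s \<in> R" "s \<le> length h" "\<And>l. s < l \<Longrightarrow> l \<le> length h \<Longrightarrow> Suc l \<notin> R"
  shows "snd (air_kp_plan p T R sel h) =
    (real T - real s) *\<^sub>R (\<chi> j. pmf p j) - arrivals (take (length h - s) h)"
  using assms(2,3)
proof (induction h)
  case Nil
  then show ?case using assms(1) by (simp add: resolve_def remaining_demand_def)
next
  case (Cons e h)
  show ?case
  proof (cases "s = length (e # h)")
    case True
    then show ?thesis using assms(1) by (simp add: resolve_def remaining_demand_def)
  next
    case False
    then have s: "s \<le> length h" using Cons.prems by simp
    have "Suc (length (e # h)) \<notin> R" using Cons.prems(2)[of "length (e # h)"] s by simp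
    then have "snd (air_kp_plan p T R sel (e # h)) = snd (air_kp_plan p T R sel h) - axis (fst e) 1"
      by (simp add: resolve_def split: prod.splits)
    also have "snd (air_kp_plan p T R sel h) =
        (real T - real s) *\<^sub>R (\<chi> j. pmf p j) - arrivals (take (length h - s) h)"
      using s Cons.prems by (intro Cons.IH) auto
    finally show ?thesis using s by (simp add: Suc_diff_le algebra_simps)
  qed
qed

text \<open>\<open>d\<close> and the actual remaining arrivals are both near the mean, so some
  optimal hindsight plan differs from \<open>u\<close> by less than the margin of the
  decision.\<close>

lemma air_kp_lossless:
  fixes A :: "real^'n^'m"
  assumes A: "\<And>i j. 0 \<le> A $ i $ j" and \<rho>: "\<And>i. 0 \<le> \<rho> $ i"
    and sel: "optimal_selection A r \<rho> p T R sel" and R: "1 \<in> R"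
    and h: "h \<in> set_pmf (trajectory p (air_kp A \<rho> p T R sel) t)" and t: "t < T"
    and s: "Suc s \<in> R" "s \<le> t" "\<And>l. s < l \<Longrightarrow> l \<le> t \<Longrightarrow> Suc l \<notin> R"
    and \<kappa>: "0 \<le> \<kappa>" "\<And>b d d' u \<delta>. 0 \<le> b \<Longrightarrow> 0 \<le> d' \<Longrightarrow> lp_optimal A r b d u \<Longrightarrow> (\<And>j. \<bar>d' $ j - d $ j\<bar> \<le> \<delta>) \<Longrightarrow>
       \<exists>y. lp_optimal A r b d' y \<and> (\<forall>j. \<bar>y $ j - u $ j\<bar> \<le> \<kappa> * \<delta>)"
    and q: "\<And>j. q \<le> pmf p j" and n: "8 \<le> real (T - t) * q"
    and c: "c = q / (16 * (\<kappa> + 1))"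
    and past: "\<And>i. \<bar>arrivals (take (t - s) h) $ i - real (t - s) * pmf p i\<bar> \<le> c * real (T - t)"
    and future: "\<And>i. \<bar>(v + axis j 1) $ i - real (T - t) * pmf p i\<bar> \<le> c * real (T - t)"
    and v: "0 \<le> v" and x: "x = air_kp_accepts A \<rho> p T R sel h j"
  shows "lp_value A r (inventory A (real T *\<^sub>R \<rho>) h) (v + axis j 1) \<le>
      earned r x j + lp_value A r (inventory A (real T *\<^sub>R \<rho>) h - consumed A x j) v"
proof -
  \<comment> \<open>\<open>N\<close> is a lower bound for the expected remaining arrivals of each
    type, \<open>D\<close> the permitted deviation.\<close>
  define N where "N = real (T - t) * q"
  define D where "D = c * real (T - t)"
  have N8: "8 \<le> N" using n unfolding N_def .
  have kc: "2 * (\<kappa> + 1) * c = q / 8" using \<kappa>(1) by (simp add: c field_simps)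
  have "2 * (\<kappa> + 1) * D = (2 * (\<kappa> + 1) * c) * real (T - t)" by (simp only: D_def mult.assoc)
  \<comment> \<open>The 16 in \<open>c\<close> is chosen for this: the change of plan and the
    deviations together take up only \<open>N / 8\<close>.\<close>
  then have D: "2 * (\<kappa> + 1) * D = N / 8" unfolding kc N_def by simp
  have D0: "0 \<le> D" using past[of undefined] by (simp add: D_def)
  have kD: "0 \<le> \<kappa> * D" using \<kappa>(1) D0 by simp
  have D': "2 * D + 2 * (\<kappa> * D) = N / 8" using D by (simp add: algebra_simps)
  obtain u d where plan: "air_kp_plan p T R sel h = (u, d)" by force
  have len: "length h = t" by (rule length_trajectory[OF h])
  have dv: "d = (real T - real s) *\<^sub>R (\<chi> j. pmf p j) - arrivals (take (t - s) h)"
    using air_kp_plan_demand[of s R h p T sel] s len plan by simp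
  have d: "d $ i = real (T - t) * pmf p i - (arrivals (take (t - s) h) $ i - real (t - s) * pmf p i)" for i
    using s t by (simp add: dv algebra_simps of_nat_diff)
  have dN: "\<bar>d $ i - real (T - t) * pmf p i\<bar> \<le> D" for i
    using past[of i] unfolding d D_def by linarith
  have Np: "N \<le> real (T - t) * pmf p i" for i
    unfolding N_def by (intro mult_left_mono q) auto
  have dN2: "N / 2 \<le> d $ i" for i using dN[of i] Np[of i] D' kD D0 N8 by linarith
  have d1: "1 \<le> d $ i" for i using dN2[of i] N8 by linarith
  have d2: "2 \<le> d $ i" for i using dN2[of i] N8 by linarith
  have opt: "lp_optimal A r (inventory A (real T *\<^sub>R \<rho>) h) d u"
    by (rule air_kp_plan_optimal[OF A \<rho> sel R h plan d1])
  then have feas: "lp_feasible A (inventory A (real T *\<^sub>R \<rho>) h) d u" by (simp add: lp_optimal_iff)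
  have "0 \<le> v + axis j 1" using v by (auto simp: less_eq_vec_def axis_def)
  moreover have "\<bar>(v + axis j 1) $ i - d $ i\<bar> \<le> 2 * D" for i
    using dN[of i] future[of i] unfolding D_def by linarith
  ultimately obtain y where y: "lp_optimal A r (inventory A (real T *\<^sub>R \<rho>) h) (v + axis j 1) y"
    "\<And>i. \<bar>y $ i - u $ i\<bar> \<le> \<kappa> * (2 * D)"
    using \<kappa>(2)[OF air_kp_inventory_nonneg[OF \<rho> h] _ opt] by blast
  have yu: "\<bar>y $ j - u $ j\<bar> \<le> N / 8 - 2 * D" using y(2)[of j] D' by simp
  show ?thesis
  proof (rule lp_value_step_lossless[OF y(1)])
    assume x
    \<comment> \<open>Acceptance gives \<open>u $ j \<ge> d $ j / 2 \<ge> N / 4\<close>, of which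
      the hindsight plan keeps at least \<open>N / 8 \<ge> 1\<close>.\<close>
    then have "d $ j - u $ j \<le> u $ j" unfolding x air_kp_accepts_def by (simp add: plan)
    then show "1 \<le> y $ j" using yu dN2[of j] D0 N8 by linarith
  next
    assume "\<not> x"
    \<comment> \<open>Rejection leaves slack at least \<open>N / 4\<close>. Deviations and change of
      plan use \<open>N / 8\<close>, and the current customer one unit, again at most
      \<open>N / 8\<close>.\<close>
    then have "d $ j / 2 \<le> d $ j - u $ j"
      using air_kp_reject_slack[OF A plan feas d2] x by blast
    moreover have "d $ j \<le> v $ j + 1 + 2 * D"
      using dN[of j] future[of j] unfolding D_def[symmetric] by simp
    ultimately show "y $ j \<le> v $ j" using yu dN2[of j] N8 by linarith
  qed
qed

section \<open>Re-solving times and summation of the losses\<close>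

text \<open>For \<open>T > 3\<close> the exponent is at most \<open>1 / log 3 T\<close>, and
  \<open>T\<close> raised to that power is 3; for \<open>T \<le> 3\<close> an exponent of at most 1
  suffices.\<close>

lemma last_resolving_exponent:
  fixes \<beta> :: real
  assumes \<beta>: "0 < \<beta>" "\<beta> < 1" and T: "1 \<le> T"
  shows "real T powr (\<beta> ^ nat \<lceil>log (1 / \<beta>) (log 3 (real T))\<rceil>) \<le> 3"
proof -
  define K where "K = nat \<lceil>log (1 / \<beta>) (log 3 (real T))\<rceil>"
  have "real T powr (\<beta> ^ K) \<le> 3"
  proof (cases "T \<le> 3")
    case True
    have "real T powr (\<beta> ^ K) \<le> real T powr 1"
      using T \<beta> by (intro powr_mono) (auto simp: power_le_one)
    then show ?thesis using True T by simp
  next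
    case False
    define L where "L = log 3 (real T)"
    have L: "L > 1" using False by (simp add: L_def less_log_iff)
    have "log (1 / \<beta>) L \<le> real K" unfolding K_def L_def[symmetric] by linarith
    then have "L \<le> (1 / \<beta>) powr real K"
      using L \<beta> by (simp add: log_le_iff)
    also have "\<dots> = 1 / \<beta> ^ K" using \<beta> by (simp add: powr_realpow power_one_over)
    finally have "\<beta> ^ K \<le> 1 / L" using L \<beta> by (simp add: field_simps)
    then have "real T powr (\<beta> ^ K) \<le> real T powr (1 / L)" using T by (intro powr_mono) auto
    also have "real T powr (1 / L) = (3 powr L) powr (1 / L)" using T by (simp add: L_def)
    also have "\<dots> = 3" using L by (simp add: powr_powr)
    finally show ?thesis .
  qed
  then show ?thesis by (simp add: K_def)
qed

text \<open>\<open>s\<close> and \<open>t\<close> are history lengths: \<open>T - s\<close> periods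
  remained when the plan was computed, \<open>T - t\<close> remain now.\<close>

lemma last_resolving_time:
  fixes \<beta> :: real
  assumes \<beta>: "0 < \<beta>" "\<beta> < 1" and t: "t < T"
  obtains s where "Suc s \<in> resolving_set \<beta> T" "s \<le> t"
    "\<And>l. s < l \<Longrightarrow> l \<le> t \<Longrightarrow> Suc l \<notin> resolving_set \<beta> T"
    "T - s \<le> 4 \<or> real (T - s) powr \<beta> \<le> 2 * real (T - t)"
proof -
  let ?R = "resolving_set \<beta> T"
  define K where "K = nat \<lceil>log (1 / \<beta>) (log 3 (real T))\<rceil>"
  \<comment> \<open>Periods left at the re-solving of index \<open>k\<close>, up to rounding;
    \<open>b 0 = T\<close> stands for the initial one.\<close>
  define b where "b k = real T powr (\<beta> ^ k)" for k
  have R: "?R = {1} \<union> (\<lambda>k. nat \<lceil>real T - b k\<rceil>) ` {1..K}"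
    by (simp add: resolving_set_def K_def b_def)
  define s where "s = Max {l. l \<le> t \<and> Suc l \<in> ?R}"
  have fin: "finite {l. l \<le> t \<and> Suc l \<in> ?R}" by simp
  have "0 \<in> {l. l \<le> t \<and> Suc l \<in> ?R}" by (simp add: R)
  then have "s \<in> {l. l \<le> t \<and> Suc l \<in> ?R}" unfolding s_def by (intro Max_in fin) auto
  then have s: "s \<le> t" "Suc s \<in> ?R" by auto
  have max: "l \<le> s" if "l \<le> t" "Suc l \<in> ?R" for l
    unfolding s_def using that by (intro Max_ge fin) auto
  have "\<exists>k\<le>K. real T - real (Suc s) \<le> b k"
  proof (cases "Suc s = 1")
    case True
    then show ?thesis using t by (intro exI[of _ 0]) (simp add: b_def)
  next
    case False
    then obtain k where k: "k \<in> {1..K}" "Suc s = nat \<lceil>real T - b k\<rceil>" using s(2) by (auto simp: R)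
    then show ?thesis by (intro exI[of _ k] conjI) (simp, linarith)
  qed
  moreover define Q where "Q = {k. k \<le> K \<and> real T - real (Suc s) \<le> b k}"
  ultimately have "Q \<noteq> {}" by blast
  \<comment> \<open>Rounding may let several indices share a period, so the largest admissible one
    is taken.\<close>
  define k where "k = Max Q"
  have finQ: "finite Q" by (simp add: Q_def)
  then have "k \<in> Q" unfolding k_def using \<open>Q \<noteq> {}\<close> by (intro Max_in)
  then have k: "k \<le> K" "real T - real (Suc s) \<le> b k" by (auto simp: Q_def)
  have kmax: "m \<le> k" if "m \<le> K" "real T - real (Suc s) \<le> b m" for m
    unfolding k_def using that by (intro Max_ge finQ) (simp add: Q_def)
  have "T - s \<le> 4 \<or> real (T - s) powr \<beta> \<le> 2 * real (T - t)"
  proof (cases "k = K")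
    case True
    then have "real T - real (Suc s) \<le> 3"
      using k(2) last_resolving_exponent[OF \<beta>, of T] t by (simp add: b_def K_def)
    then have "T - s \<le> 4" by linarith
    then show ?thesis ..
  next
    case False
    define l where "l = nat \<lceil>real T - b (Suc k)\<rceil>"
    have "l \<in> ?R" using False k(1) by (auto simp: R l_def)
    \<comment> \<open>Maximality of \<open>k\<close> puts the time of index \<open>Suc k\<close>
      after \<open>Suc s\<close>; maximality of \<open>s\<close> then puts it after the current
      period.\<close>
    have gap: "real (Suc s) < real T - b (Suc k)" using kmax[of "Suc k"] False k(1) by force
    then have "Suc s < l" by (simp add: l_def) linarith
    then have "t < l - 1" using max[of "l - 1"] \<open>l \<in> ?R\<close> by force
    then have "Suc t < nat \<lceil>real T - b (Suc k)\<rceil>" by (simp add: l_def)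
    then have "real (Suc t) < real T - b (Suc k)" by linarith
    then have small: "b (Suc k) < real (T - t)" using t by (simp add: of_nat_diff)
    show ?thesis
    proof (cases "T - s = 1")
      case True
      then show ?thesis by simp
    next
      case False
      \<comment> \<open>Since \<open>T - s \<ge> 2\<close>, doubling absorbs the shift by one
        period.\<close>
      have "real (T - s) powr \<beta> \<le> (2 * (real T - real (Suc s))) powr \<beta>"
        using False s(1) t \<beta> by (intro powr_mono2) (auto simp: of_nat_diff)
      also have "\<dots> = 2 powr \<beta> * (real T - real (Suc s)) powr \<beta>"
        using s(1) t by (intro powr_mult)
      also have "\<dots> \<le> 2 powr 1 * b k powr \<beta>"
        using k(2) \<beta> s(1) t by (intro mult_mono powr_mono powr_mono2) auto
      also have "b k powr \<beta> = b (Suc k)" by (simp add: b_def powr_powr mult.commute)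
      finally show ?thesis using small by simp
    qed
  qed
  then show thesis using that[of s] s max by (meson not_le)
qed

section \<open>Summing the expected losses\<close>

lemma summable_stretched_exponential:
  fixes a g :: real
  assumes "0 < a" "0 < g"
  shows "summable (\<lambda>n. exp (- (a * real n powr g)))"
proof (rule summable_comparison_test_bigo)
  show "(\<lambda>n. exp (- (a * real n powr g))) \<in> O(\<lambda>n. inverse (real n ^ 2))"
    using assms by real_asymp
  show "summable (\<lambda>n. norm (inverse (real n ^ 2)))"
    using inverse_power_summable[of 2, where ?'a = real] by (simp add: power_inverse)
qed

text \<open>Strict, so that vectors outside satisfy the non-strict hypotheses of
  \<open>air_kp_lossless\<close>.\<close>

definition atypical :: "'n::finite pmf \<Rightarrow> nat \<Rightarrow> real \<Rightarrow> (real^'n) set" where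
  "atypical p k D = {v. \<exists>i. D < \<bar>v $ i - real k * pmf p i\<bar>}"

lemma prob_atypical:
  fixes p :: "'n::finite pmf"
  assumes "k \<le> N" "0 < D"
  shows "measure_pmf.prob (demand p k) (atypical p k D) \<le> 2 * real CARD('n) * exp (- (2 * D\<^sup>2 / real N))"
proof -
  have "measure_pmf.prob (demand p k) (atypical p k D) \<le>
      measure_pmf.prob (demand p k) (\<Union>i. {v. D \<le> \<bar>v $ i - real k * pmf p i\<bar>})"
    by (intro measure_pmf.finite_measure_mono) (auto simp: atypical_def intro: less_imp_le)
  also have "\<dots> \<le> (\<Sum>i\<in>UNIV. measure_pmf.prob (demand p k) {v. D \<le> \<bar>v $ i - real k * pmf p i\<bar>})"
    by (intro measure_pmf.finite_measure_subadditive_finite) auto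
  also have "\<dots> \<le> (\<Sum>i\<in>(UNIV::'n set). 2 * exp (- (2 * D\<^sup>2 / real N)))"
    by (intro sum_mono demand_concentration assms)
  finally show ?thesis by simp
qed

lemma expected_atypical_cost:
  fixes p :: "'n::finite pmf"
  assumes "k \<le> N" "0 < D" "0 \<le> M"
  shows "measure_pmf.expectation (demand p k) (\<lambda>v. M * indicator (atypical p k D) v) \<le>
    M * (2 * real CARD('n) * exp (- (2 * D\<^sup>2 / real N)))"
  using prob_atypical[OF assms(1,2), of p] assms(3) by (simp add: mult_left_mono)

lemma air_kp_consumed_le:
  assumes "0 \<le> inventory A (real T *\<^sub>R \<rho>) h"
  shows "0 \<le> inventory A (real T *\<^sub>R \<rho>) h - consumed A (air_kp_accepts A \<rho> p T R sel h j) j"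
  using assms by (auto simp: consumed_def air_kp_accepts_def split: prod.splits)

text \<open>Expresses Hoeffding's exponent through \<open>n\<close> alone, as
  \<open>N \<le> (2 * n) powr (1 / \<beta>)\<close>.\<close>

lemma square_over_powr_le:
  fixes c n N \<beta> :: real
  assumes "0 < \<beta>" "0 < n" "0 < N" "N powr \<beta> \<le> 2 * n"
  shows "2 * c\<^sup>2 / 2 powr (1 / \<beta>) * n powr (2 - 1 / \<beta>) \<le> 2 * (c * n)\<^sup>2 / N"
proof -
  have "N = (N powr \<beta>) powr (1 / \<beta>)" using assms by (simp add: powr_powr)
  also have "\<dots> \<le> (2 * n) powr (1 / \<beta>)" using assms by (intro powr_mono2) auto
  also have "\<dots> = 2 powr (1 / \<beta>) * n powr (1 / \<beta>)" using assms by (intro powr_mult)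
  finally have "2 * (c * n)\<^sup>2 / (2 powr (1 / \<beta>) * n powr (1 / \<beta>)) \<le> 2 * (c * n)\<^sup>2 / N"
    using assms by (intro divide_left_mono) auto
  moreover have "n powr (2 - 1 / \<beta>) = n\<^sup>2 / n powr (1 / \<beta>)"
    using assms by (simp add: powr_diff)
  ultimately show ?thesis by (simp add: power_mult_distrib)
qed

text \<open>\<open>M\<close>, \<open>n0\<close> and \<open>a\<close> are fixed before
  \<open>T\<close>, \<open>t\<close> and \<open>sel\<close>. Near the end a period costs at most
  \<open>M\<close>; earlier, only atypical arrivals cost anything.\<close>

lemma air_kp_step_loss:
  fixes A :: "real^'n^'m" and p :: "'n pmf" and \<beta> :: real
  assumes r: "\<And>j. 0 \<le> r $ j" and A: "\<And>i j. 0 \<le> A $ i $ j" and \<rho>: "\<And>i. 0 \<le> \<rho> $ i"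
    and p: "\<And>j. 0 < pmf p j" and \<beta>: "0 < \<beta>" "\<beta> < 1"
  obtains M n0 a where "0 \<le> M" "0 < a"
    "\<And>T sel t. optimal_selection A r \<rho> p T (resolving_set \<beta> T) sel \<Longrightarrow> t < T \<Longrightarrow>
      hindsight_value A r (real T *\<^sub>R \<rho>) p T (air_kp A \<rho> p T (resolving_set \<beta> T) sel) t \<le>
      hindsight_value A r (real T *\<^sub>R \<rho>) p T (air_kp A \<rho> p T (resolving_set \<beta> T) sel) (Suc t) +
      ((if T - t < n0 then M else 0) +
       4 * real CARD('n) * M * exp (- (a * real (T - t) powr (2 - 1 / \<beta>))))"
proof -
  obtain M where M: "0 \<le> M"
    "\<And>b v x j. 0 \<le> b - consumed A x j \<Longrightarrow> 0 \<le> v \<Longrightarrow>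
      lp_value A r b (v + axis j 1) \<le> earned r x j + lp_value A r (b - consumed A x j) v + M"
    by (rule lp_value_step_bounded[OF r A]) blast
  obtain \<kappa> where \<kappa>: "0 \<le> \<kappa>"
    "\<And>b d d' u \<delta>. 0 \<le> b \<Longrightarrow> 0 \<le> d' \<Longrightarrow> lp_optimal A r b d u \<Longrightarrow> (\<And>j. \<bar>d' $ j - d $ j\<bar> \<le> \<delta>) \<Longrightarrow>
       \<exists>y. lp_optimal A r b d' y \<and> (\<forall>j. \<bar>y $ j - u $ j\<bar> \<le> \<kappa> * \<delta>)"
    by (rule lp_optimal_lipschitz[of A r]) blast
  define q where "q = Min (range (pmf p))"
  have q: "q \<le> pmf p j" "0 < q" for j using p by (auto simp: q_def)
  define c where "c = q / (16 * (\<kappa> + 1))"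
  have c: "0 < c" using q \<kappa>(1) by (simp add: c_def add_nonneg_pos)
  \<comment> \<open>The 5 rules out the alternative \<open>T - s \<le> 4\<close>;
    \<open>8 / q\<close> yields \<open>8 \<le> real n * q\<close>.\<close>
  define n0 where "n0 = max 5 (nat \<lceil>8 / q\<rceil>)"
  define a where "a = 2 * c\<^sup>2 / 2 powr (1 / \<beta>)"
  show thesis
  proof
    show "0 \<le> M" by fact
    show "0 < a" using c by (simp add: a_def)
    fix T t :: nat and sel :: "'n history \<Rightarrow> real^'n"
    let ?R = "resolving_set \<beta> T"
    let ?\<mu> = "air_kp A \<rho> p T ?R sel"
    let ?B = "real T *\<^sub>R \<rho>"
    assume sel: "optimal_selection A r \<rho> p T ?R sel" and t: "t < T"
    define n where "n = T - t"
    have n: "0 < n" "n \<le> T" using t by (auto simp: n_def)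
    have crude: "lp_value A r (inventory A ?B h) (v + axis j 1) \<le>
        earned r (air_kp_accepts A \<rho> p T ?R sel h j) j +
        lp_value A r (inventory A ?B h - consumed A (air_kp_accepts A \<rho> p T ?R sel h j) j) v + M"
      if "h \<in> set_pmf (trajectory p ?\<mu> t)" "v \<in> set_pmf (demand p (T - Suc t))" for h j v
      using that by (intro M(2) air_kp_consumed_le air_kp_inventory_nonneg[OF \<rho>] demand_nonneg)
    show "hindsight_value A r ?B p T ?\<mu> t \<le> hindsight_value A r ?B p T ?\<mu> (Suc t) +
      ((if n < n0 then M else 0) + 4 * real CARD('n) * M * exp (- (a * real n powr (2 - 1 / \<beta>))))"
    proof (cases "n < n0")
      case True
      have "hindsight_value A r ?B p T ?\<mu> t \<le> hindsight_value A r ?B p T ?\<mu> (Suc t) +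
        (measure_pmf.expectation (trajectory p ?\<mu> t) (\<lambda>_. M) + measure_pmf.expectation (demand p (T - t)) (\<lambda>_. 0))"
        using crude by (intro hindsight_value_le_Suc[OF t air_kp_eq_return]) auto
      moreover define e where "e = 4 * real CARD('n) * M * exp (- (a * real n powr (2 - 1 / \<beta>)))"
      moreover have "0 \<le> e" unfolding e_def using M(1) by (intro mult_nonneg_nonneg) auto
      ultimately show ?thesis unfolding e_def[symmetric] using True by simp
    next
      case False
      then have "n0 \<le> n" by simp
      moreover have "5 \<le> n0" unfolding n0_def by (rule max.cobounded1)
      moreover have "nat \<lceil>8 / q\<rceil> \<le> n0" unfolding n0_def by (rule max.cobounded2)
      ultimately have n0: "5 \<le> n0" "nat \<lceil>8 / q\<rceil> \<le> n0" "n0 \<le> n" by blast+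
      then have n5: "5 \<le> n" by linarith
      have "8 / q \<le> real (nat \<lceil>8 / q\<rceil>)" by (rule real_nat_ceiling_ge)
      also have "\<dots> \<le> real n" using n0 by linarith
      finally have "8 / q \<le> real n" .
      then have nq: "8 \<le> real n * q" using q(2) by (simp add: field_simps)
      obtain s where s: "Suc s \<in> ?R" "s \<le> t" "\<And>l. s < l \<Longrightarrow> l \<le> t \<Longrightarrow> Suc l \<notin> ?R"
        and gap: "T - s \<le> 4 \<or> real (T - s) powr \<beta> \<le> 2 * real (T - t)"
        by (rule last_resolving_time[OF \<beta> t]) blast
      define N where "N = T - s"
      have N: "n \<le> N" "t - s \<le> N" "0 < N" "real N powr \<beta> \<le> 2 * real n"
        using s(2) t gap n5 by (auto simp: N_def n_def)
      define D where "D = c * real n"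
      have D: "0 < D" using c n by (simp add: D_def)
      define E where "E = M * (2 * real CARD('n) * exp (- (a * real n powr (2 - 1 / \<beta>))))"
      have E: "M * (2 * real CARD('n) * exp (- (2 * D\<^sup>2 / real N))) \<le> E"
        using square_over_powr_le[of \<beta> "real n" "real N" c] \<beta> n N M(1)
        unfolding E_def a_def D_def by (intro mult_left_mono) auto
      \<comment> \<open>The crude loss \<open>M\<close> is charged once for an atypical past and
        once for an atypical future.\<close>
      let ?f = "\<lambda>h. M * indicator (atypical p (t - s) D) (arrivals (take (t - s) h))"
      let ?g = "\<lambda>w. M * indicator (atypical p n D) w"
      have "hindsight_value A r ?B p T ?\<mu> t \<le> hindsight_value A r ?B p T ?\<mu> (Suc t) +
        (measure_pmf.expectation (trajectory p ?\<mu> t) ?f + measure_pmf.expectation (demand p (T - t)) ?g)"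
      proof (rule hindsight_value_le_Suc[OF t air_kp_eq_return])
        fix h j v
        assume h: "h \<in> set_pmf (trajectory p ?\<mu> t)" and v: "v \<in> set_pmf (demand p (T - Suc t))"
        let ?x = "air_kp_accepts A \<rho> p T ?R sel h j"
        show "lp_value A r (inventory A ?B h) (v + axis j 1) \<le>
          earned r ?x j + lp_value A r (inventory A ?B h - consumed A ?x j) v + (?f h + ?g (v + axis j 1))"
        proof (cases "arrivals (take (t - s) h) \<in> atypical p (t - s) D \<or> v + axis j 1 \<in> atypical p n D")
          case True
          then have "M \<le> ?f h + ?g (v + axis j 1)" using M(1) by (auto simp: indicator_def)
          then show ?thesis using crude[OF h v, of j] by linarith
        next
          case False
          have "lp_value A r (inventory A ?B h) (v + axis j 1) \<le>
              earned r ?x j + lp_value A r (inventory A ?B h - consumed A ?x j) v"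
          proof (rule air_kp_lossless[OF A \<rho> sel _ h t s \<kappa> q(1) _ c_def _ _ demand_nonneg[OF v] refl])
            show "1 \<in> ?R" by (simp add: resolving_set_def)
            show "8 \<le> real (T - t) * q" using nq unfolding n_def .
            show "\<bar>arrivals (take (t - s) h) $ i - real (t - s) * pmf p i\<bar> \<le> c * real (T - t)" for i
              using False unfolding atypical_def D_def n_def by (simp add: not_less del: of_nat_diff)
            show "\<bar>(v + axis j 1) $ i - real (T - t) * pmf p i\<bar> \<le> c * real (T - t)" for i
              using False unfolding atypical_def D_def n_def by (simp add: not_less del: of_nat_diff)
          qed
          then show ?thesis using False by simp
        qed
      qed
      moreover have "measure_pmf.expectation (trajectory p ?\<mu> t) ?f \<le> E"
      proof -
        have "measure_pmf.expectation (trajectory p ?\<mu> t) ?f =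
            measure_pmf.expectation (map_pmf (\<lambda>h. arrivals (take (t - s) h)) (trajectory p ?\<mu> (s + (t - s))))
              (\<lambda>v. M * indicator (atypical p (t - s) D) v)"
          using s(2) by (simp only: integral_map_pmf le_add_diff_inverse)
        also have "\<dots> = measure_pmf.expectation (demand p (t - s)) (\<lambda>v. M * indicator (atypical p (t - s) D) v)"
          unfolding recent_arrivals_trajectory ..
        also have "\<dots> \<le> E" using expected_atypical_cost[OF N(2) D M(1)] E by (rule order_trans)
        finally show ?thesis .
      qed
      moreover have "measure_pmf.expectation (demand p (T - t)) ?g \<le> E"
        unfolding n_def[symmetric] using expected_atypical_cost[OF N(1) D M(1)] E by (rule order_trans)
      ultimately have "hindsight_value A r ?B p T ?\<mu> t \<le> hindsight_value A r ?B p T ?\<mu> (Suc t) + (E + E)"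
        by linarith
      moreover have "4 * real CARD('n) * M * exp (- (a * real n powr (2 - 1 / \<beta>))) = E + E"
        by (simp add: E_def)
      ultimately show ?thesis using False by (simp only: if_False add_0)
    qed
  qed
qed

text \<open>Indexing by remaining periods bounds the total loss of every horizon by one
  series.\<close>

lemma sum_backwards_le_suminf:
  fixes F :: "nat \<Rightarrow> real"
  assumes "summable F" "\<And>n. 0 \<le> F n"
  shows "(\<Sum>t<T. F (T - t)) \<le> suminf F"
proof -
  have "(\<Sum>t<T. F (T - t)) = (\<Sum>n\<in>{1..T}. F n)"
    by (rule sum.reindex_bij_witness[of _ "\<lambda>n. T - n" "\<lambda>t. T - t"]) auto
  also have "\<dots> \<le> suminf F" by (intro sum_le_suminf assms) auto
  finally show ?thesis .
qed

lemma expected_reward_feasible: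
  assumes "feasible_policy A \<rho> p T \<mu>"
  shows "expected_reward r p T \<mu> = hindsight_value A r (real T *\<^sub>R \<rho>) p T \<mu> T"
  unfolding expected_reward_def using assms
  by (intro hindsight_value_final[symmetric]) (auto simp: feasible_policy_def)

lemma expected_reward_le_hindsight:
  assumes "feasible_policy A \<rho> p T \<mu>"
  shows "expected_reward r p T \<mu> \<le> measure_pmf.expectation (demand p T) (lp_value A r (real T *\<^sub>R \<rho>))"
proof -
  have "hindsight_value A r (real T *\<^sub>R \<rho>) p T \<mu> t \<le> hindsight_value A r (real T *\<^sub>R \<rho>) p T \<mu> 0"
    if "t \<le> T" for t
    using that
  proof (induction t)
    case (Suc t)
    then have "hindsight_value A r (real T *\<^sub>R \<rho>) p T \<mu> (Suc t) \<le> hindsight_value A r (real T *\<^sub>R \<rho>) p T \<mu> t"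
      using assms by (intro hindsight_value_Suc_le) (auto simp: feasible_policy_def simp del: trajectory.simps)
    with Suc show ?case by simp
  qed simp
  from this[of T] show ?thesis by (simp add: expected_reward_feasible[OF assms])
qed

theorem theorem3:
  fixes A :: "real^'n^'m" and r :: "real^'n" and \<rho> :: "real^'m" and p :: "'n pmf" and \<beta> :: real
  assumes "\<And>j. 0 \<le> r $ j"
    and "\<And>i j. 0 \<le> A $ i $ j"
    and "\<And>i. 0 \<le> \<rho> $ i"
    and "\<And>j. 0 < pmf p j"
    and "1 / 2 < \<beta>" and "\<beta> < 1"
  shows "\<exists>C. \<forall>T\<ge>1. \<forall>sel.
           optimal_selection A r \<rho> p T (resolving_set \<beta> T) sel \<longrightarrow>
           \<bar>regret A r \<rho> p T (air_kp A \<rho> p T (resolving_set \<beta> T) sel)\<bar> \<le> C"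
proof -
  obtain M n0 a where M: "0 \<le> M" and a: "0 < a"
    and step: "\<And>T sel t. optimal_selection A r \<rho> p T (resolving_set \<beta> T) sel \<Longrightarrow> t < T \<Longrightarrow>
      hindsight_value A r (real T *\<^sub>R \<rho>) p T (air_kp A \<rho> p T (resolving_set \<beta> T) sel) t \<le>
      hindsight_value A r (real T *\<^sub>R \<rho>) p T (air_kp A \<rho> p T (resolving_set \<beta> T) sel) (Suc t) +
      ((if T - t < n0 then M else 0) +
       4 * real CARD('n) * M * exp (- (a * real (T - t) powr (2 - 1 / \<beta>))))"
    using assms by (rule_tac air_kp_step_loss[of r A \<rho> p \<beta>]) auto
  define F where "F n = (if n < n0 then M else 0) +
      4 * real CARD('n) * M * exp (- (a * real n powr (2 - 1 / \<beta>)))" for n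
  have F0: "0 \<le> F n" for n using M by (simp add: F_def)
  \<comment> \<open>This is where \<open>\<beta> > 1 / 2\<close> makes the losses summable.\<close>
  have "0 < 2 - 1 / \<beta>" using assms(5) by (simp add: field_simps)
  then have sumF: "summable F"
    unfolding F_def using a
    by (intro summable_add summable_mult summable_stretched_exponential)
       (auto intro: summable_finite[of "{..<n0}"])
  have "\<bar>regret A r \<rho> p T (air_kp A \<rho> p T (resolving_set \<beta> T) sel)\<bar> \<le> suminf F"
    if sel: "optimal_selection A r \<rho> p T (resolving_set \<beta> T) sel" for T sel
  proof -
    let ?\<mu> = "air_kp A \<rho> p T (resolving_set \<beta> T) sel"
    let ?H = "hindsight_value A r (real T *\<^sub>R \<rho>) p T ?\<mu>"
    define U where "U = measure_pmf.expectation (demand p T) (lp_value A r (real T *\<^sub>R \<rho>))"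
    have feas: "feasible_policy A \<rho> p T ?\<mu>"
      unfolding feasible_policy_def by (auto intro: air_kp_inventory_nonneg[OF assms(3)])
    have "?H 0 \<le> ?H t + (\<Sum>i<t. F (T - i))" if "t \<le> T" for t
      using that
    proof (induction t)
      case (Suc t)
      then show ?case using step[OF sel, of t] by (simp add: F_def)
    qed simp
    from this[of T] have low: "U \<le> expected_reward r p T ?\<mu> + suminf F"
      using sum_backwards_le_suminf[OF sumF F0, of T]
      by (simp add: U_def expected_reward_feasible[OF feas])
    have up: "expected_reward r p T \<mu> \<le> U" if "feasible_policy A \<rho> p T \<mu>" for \<mu>
      unfolding U_def using that by (rule expected_reward_le_hindsight)
    \<comment> \<open>AIR-KP is itself feasible and \<open>U\<close> bounds the supremum, so the
      regret is nonnegative, which settles the absolute value.\<close>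
    have "expected_reward r p T ?\<mu> \<le> optimal_value A r \<rho> p T"
      unfolding optimal_value_def using feas up by (intro cSUP_upper bdd_aboveI2) auto
    moreover have "optimal_value A r \<rho> p T \<le> U"
      unfolding optimal_value_def using feas up by (intro cSUP_least) auto
    ultimately show ?thesis using low by (simp add: regret_def)
  qed
  then show ?thesis by blast
qed

end
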